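(* Let $G$ be a 2-dd all of whose alternating cycles are odd, and suppose that $G$ is odd (i.e. $i(F)$ is odd for every factor $F$ of $G$). Let $S=\{u,v\}$ be a minimal split-set of $G$ such that splitting $S$ yields the split components $G_1$ and $G_2$, where $G_1$ contains $u^{in}$ and $v^{out}$, and $G_2$ contains $u^{out}$ and $v^{in}$. Let $G'_1$ be the 2-dd obtained from $G_1$ by splicing $u^{in}$ with $v^{out}$, and let $G'_2$ be the 2-dd obtained from $G_2$ by splicing $u^{out}$ with $v^{in}$. Then: (a) $G$ is Hamiltonian if and only if both $G'_1$ and $G'_2$ are Hamiltonian. (b) If $G'_1$ or $G'_2$ is even, then both $G'_1$ and $G'_2$ are even (and $G$ is non-Hamiltonian).
   Context: Digraphs are finite; arcs are ordered pairs $(u,v)$ of vertices ($u$ the start-vertex, $v$ the end-vertex); loops are allowed. For a vertex $v$, $v_{in}$ and $v_{out}$ are the sets of arcs with end-vertex $v$, respectively start-vertex $v$ (a loop belongs to both). A 2-digraph is a digraph in which every vertex $v$ satisfies $(|v_{in}|,|v_{out}|)\in\{(2,0),(0,2),(2,2)\}$; $v$ is called an exit, entry or saturated vertex respectively. A 2-dd is a 2-digraph all of whose vertices are saturated. Components are connected components of the underlying undirected graph. An alternating cycle (AC) of a 2-digraph is a sequence $(e_0,\dots,e_{2r-1})$ of $2r$ distinct arcs such that, with indices mod $2r$, $e_i$ and $e_{i+1}$ have a common end-vertex if $i$ is even and a common start-vertex if $i$ is odd. It is odd (even) if $r$ is odd (even). The arcs of a 2-digraph are uniquely partitioned into ACs.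 A factor $F$ of a 2-digraph $G$ is a spanning subgraph containing exactly one arc of $v_{in}$ for each vertex $v$ with $v_{in}\ne\emptyset$ and exactly one arc of $v_{out}$ for each $v$ with $v_{out}\neq\emptyset$; it is a disjoint union of simple cycles (a loop counts as a cycle) and simple paths from entry vertices to exit vertices. The index $i(F)$ is the number of cycles of $F$. A 2-dd is odd (even) if $i(F)$ is odd (even) for every factor $F$ of it. A 2-dd is Hamiltonian if it has a directed cycle through all its vertices. Splitting a saturated vertex $v$ means replacing it by two vertices $v^{in},v^{out}$, where the two arcs of $v_{in}$ become in-arcs of $v^{in}$ and the two arcs of $v_{out}$ become out-arcs of $v^{out}$. Splicing is the inverse operation: identifying an entry vertex with an exit vertex to form a new saturated vertex. A split-set is a set $S$ of saturated vertices such that splitting all vertices of $S$ increases the number of components; it is minimal if no proper subset is a split-set. The components of the graph resulting from splitting $S$ are the split components; here they are exactly $G_1$ and $G_2$. *)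

theory Defs
  imports "Graph_Theory.Graph_Theory"
begin

definition two_digraph :: "'a pair_pre_digraph \<Rightarrow> bool" where
  "two_digraph G \<longleftrightarrow> pair_fin_digraph G \<and>
     (\<forall>v \<in> pverts G. (in_degree G v, out_degree G v) \<in> {(2, 0), (0, 2), (2, 2)})"

definition saturated :: "'a pair_pre_digraph \<Rightarrow> 'a \<Rightarrow> bool" where
  "saturated G v \<longleftrightarrow> v \<in> pverts G \<and> in_degree G v = 2 \<and> out_degree G v = 2"

definition two_dd :: "'a pair_pre_digraph \<Rightarrow> bool" where
  "two_dd G \<longleftrightarrow> two_digraph G \<and> (\<forall>v \<in> pverts G. saturated G v)"

text \<open>The empty list is excluded: an alternating cycle has \<open>2 * r\<close> arcs with \<open>r \<ge> 1\<close>.\<close>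

definition alternating_cycle :: "'a pair_pre_digraph \<Rightarrow> ('a \<times> 'a) list \<Rightarrow> bool" where
  "alternating_cycle G es \<longleftrightarrow>
     es \<noteq> [] \<and> even (length es) \<and> distinct es \<and> set es \<subseteq> parcs G \<and>
     (\<forall>i < length es.
        if even i then snd (es ! i) = snd (es ! (Suc i mod length es))
        else fst (es ! i) = fst (es ! (Suc i mod length es)))"

definition odd_alternating_cycle :: "'a pair_pre_digraph \<Rightarrow> ('a \<times> 'a) list \<Rightarrow> bool" where
  "odd_alternating_cycle G es \<longleftrightarrow> alternating_cycle G es \<and> odd (length es div 2)"

definition factor :: "'a pair_pre_digraph \<Rightarrow> 'a pair_pre_digraph \<Rightarrow> bool" where
  "factor G F \<longleftrightarrow> spanning F G \<and>
     (\<forall>v \<in> pverts G.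
        (in_arcs G v \<noteq> {} \<longrightarrow> card (in_arcs F v) = 1) \<and>
        (out_arcs G v \<noteq> {} \<longrightarrow> card (out_arcs F v) = 1))"

text \<open>
  The library represents a cycle by a list of arcs with a chosen starting point; passing to the
  set of arcs identifies the rotations of one and the same cycle. Loops count as cycles.
\<close>

definition index :: "'a pair_pre_digraph \<Rightarrow> nat" where
  "index F = card {set p | p. pre_digraph.cycle F p}"

definition odd_two_dd :: "'a pair_pre_digraph \<Rightarrow> bool" where
  "odd_two_dd G \<longleftrightarrow> two_dd G \<and> (\<forall>F. factor G F \<longrightarrow> odd (index F))"

definition even_two_dd :: "'a pair_pre_digraph \<Rightarrow> bool" where
  "even_two_dd G \<longleftrightarrow> two_dd G \<and> (\<forall>F. factor G F \<longrightarrow> even (index F))"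

definition hamiltonian :: "'a pair_pre_digraph \<Rightarrow> bool" where
  "hamiltonian G \<longleftrightarrow> (\<exists>p. pre_digraph.cycle G p \<and> fst ` set p = pverts G)"

text \<open>
  Connected components, as induced subgraphs; \<^const>\<open>Digraph_Component.connected\<close> is the library's connectedness of
  the underlying undirected graph and excludes the empty graph.
\<close>

definition components :: "'a pair_pre_digraph \<Rightarrow> 'a pair_pre_digraph set" where
  "components G = {H. induced_subgraph (with_proj H) G \<and> Digraph_Component.connected (with_proj H) \<and>
     \<not> (\<exists>H'. induced_subgraph (with_proj H') G \<and>
          Digraph_Component.connected (with_proj H') \<and> pverts H \<subset> pverts H')}"

text \<open>
  Vertices after splitting: \<open>Vin v\<close> and \<open>Vout v\<close> are the two parts of a split vertex \<open>v\<close>,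
  and \<open>Orig v\<close> is a vertex that was not split.
\<close>

datatype 'a split_vertex = Orig 'a | Vin 'a | Vout 'a

definition split_graph :: "'a pair_pre_digraph \<Rightarrow> 'a set \<Rightarrow> 'a split_vertex pair_pre_digraph" where
  "split_graph G S =
     \<lparr> pverts = Orig ` (pverts G - S) \<union> Vin ` S \<union> Vout ` S,
       parcs = (\<lambda>(x, y). (if x \<in> S then Vout x else Orig x, if y \<in> S then Vin y else Orig y))
                 ` parcs G \<rparr>"

text \<open>
  Splicing the exit vertex \<open>x\<close> with the entry vertex \<open>y\<close>; the resulting saturated vertex keeps
  the name \<open>x\<close>. As \<open>x\<close> has no out-arcs and \<open>y\<close> no in-arcs, no two arcs get merged.
\<close>

definition splice_verts :: "'a pair_pre_digraph \<Rightarrow> 'a \<Rightarrow> 'a \<Rightarrow> 'a pair_pre_digraph" where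
  "splice_verts G x y =
     (let r = (\<lambda>z. if z = y then x else z)
      in \<lparr> pverts = r ` pverts G, parcs = map_prod r r ` parcs G \<rparr>)"

definition split_set :: "'a pair_pre_digraph \<Rightarrow> 'a set \<Rightarrow> bool" where
  "split_set G S \<longleftrightarrow> (\<forall>v \<in> S. saturated G v) \<and>
     card (components (split_graph G S)) > card (components G)"

definition minimal_split_set :: "'a pair_pre_digraph \<Rightarrow> 'a set \<Rightarrow> bool" where
  "minimal_split_set G S \<longleftrightarrow> split_set G S \<and> \<not> (\<exists>T. T \<subset> S \<and> split_set G T)"

end

theory Submission
  imports Defs "HOL-Combinatorics.Orbits"
begin

text \<open>
  A factor of a 2-dd is the graph of a permutation \<open>p\<close> of the vertices that follows arcs, and its
  index is the number of orbits of \<open>p\<close>. Up to renaming, the disjoint union of \<open>G1'\<close> and \<open>G2'\<close> arises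
  from \<open>G\<close> by exchanging the out-arcs of \<open>u\<close> and \<open>v\<close>, so \<open>p \<mapsto> p \<circ> transpose u v\<close> turns the factors
  of \<open>G\<close> into pairs of factors of \<open>G1'\<close> and \<open>G2'\<close>. Since \<open>u\<close> and \<open>v\<close> then lie in different parts, the
  transposition splits the cycle of \<open>p\<close> through \<open>u\<close> and \<open>v\<close> into two: the index of a
  factor of \<open>G\<close> is \<open>i\<^sub>1 + i\<^sub>2 - 1\<close>, where \<open>i\<^sub>1\<close> and \<open>i\<^sub>2\<close> are the indices of the two parts. Hence it
  is \<open>1\<close> iff \<open>i\<^sub>1 = i\<^sub>2 = 1\<close>, and if it is always odd, then \<open>i\<^sub>1\<close> and \<open>i\<^sub>2\<close> always have the same parity.
  As factors of the two parts can be chosen independently and exist, one part being even forces the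
  other to be even.
\<close>

section \<open>Orbits of permutations\<close>

lemma card_Collect_bij_betw:
  assumes "bij_betw f A B" "\<And>x. x \<in> A \<Longrightarrow> Q (f x) \<longleftrightarrow> P x"
  shows "card {x \<in> A. P x} = card {y \<in> B. Q y}"
proof -
  have "f ` {x \<in> A. P x} = {y \<in> B. Q y}"
    using assms unfolding bij_betw_def by auto
  then have "bij_betw f {x \<in> A. P x} {y \<in> B. Q y}"
    by (intro bij_betw_subset[OF assms(1)]) auto
  then show ?thesis
    by (rule bij_betw_same_card)
qed

text \<open>Orbits are counted as sets, so no representatives have to be chosen; a fixed point is an
  orbit of its own, just as a loop counts as a cycle.\<close>

definition num_orbits :: "('a \<Rightarrow> 'a) \<Rightarrow> 'a set \<Rightarrow> nat" where
  "num_orbits p A = card (orbit p ` A)"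

lemma num_orbits_pos: "finite A \<Longrightarrow> x \<in> A \<Longrightarrow> num_orbits p A > 0"
  by (auto simp: num_orbits_def card_gt_0_iff)

text \<open>\<open>orbit p x\<close> is generated from \<open>p x\<close>, not from
  \<open>x\<close>; finiteness makes the iteration return to \<open>x\<close>.\<close>

lemma self_in_orbit:
  assumes "p permutes A" "finite A"
  shows "x \<in> orbit p x"
  using assms permutation_permutes permutation_self_in_orbit by metis

lemma orbit_eq:
  assumes "p permutes A" "finite A" "y \<in> orbit p x"
  shows "orbit p y = orbit p x"
  using assms by (meson cyclic_on_orbit orbit_cyclic_eq3)

text \<open>Conjugation by \<open>f\<close> carries each orbit to its image, and taking images is
  injective on subsets of \<open>A\<close>.\<close>

lemma num_orbits_map_permutation:
  assumes "p permutes A" "finite A" "bij_betw f A B"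
  shows "num_orbits (map_permutation A f p) B = num_orbits p A"
proof -
  have inj: "inj_on f A" and B: "B = f ` A"
    using assms(3) by (auto simp: bij_betw_def)
  have orb: "orbit (map_permutation A f p) (f x) = f ` orbit p x" if "x \<in> A" for x
  proof -
    have "map_permutation A f p (f y) = f (p y)" if "y \<in> orbit p x" for y
      using that \<open>x \<in> A\<close> permutes_orbit_subset[OF assms(1)] map_permutation_apply[OF inj]
      by blast
    then show ?thesis
      using orbit_inverse[of x p "map_permutation A f p" f] self_in_orbit[OF assms(1,2)]
      by metis
  qed
  have "orbit (map_permutation A f p) ` B = (`) f ` (orbit p ` A)"
    using orb by (force simp: B)
  moreover have "inj_on ((`) f) (orbit p ` A)"
    using inj_on_image_Pow[OF inj] permutes_orbit_subset[OF assms(1)]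
    by (metis PowI image_subsetI inj_on_subset)
  ultimately show ?thesis
    by (simp add: num_orbits_def card_image)
qed

text \<open>Every orbit stays on the side where it starts, and nonempty orbits on disjoint sides are
  different.\<close>

lemma num_orbits_Un:
  assumes "p permutes A" "q permutes B" "finite A" "finite B" "A \<inter> B = {}"
    and "\<And>x. x \<in> A \<Longrightarrow> r x = p x" "\<And>x. x \<in> B \<Longrightarrow> r x = q x"
  shows "num_orbits r (A \<union> B) = num_orbits p A + num_orbits q B"
proof -
  have r: "orbit r x = orbit p x" if "x \<in> A" for x
    using that self_in_orbit[OF assms(1,3)] permutes_orbit_subset[OF assms(1)] assms(6)
    by (intro orbit_cong) auto
  have s: "orbit r x = orbit q x" if "x \<in> B" for x
    using that self_in_orbit[OF assms(2,4)] permutes_orbit_subset[OF assms(2)] assms(7)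
    by (intro orbit_cong) auto
  have "orbit r ` (A \<union> B) = orbit p ` A \<union> orbit q ` B"
    using r s by (simp add: image_Un)
  moreover have "orbit p ` A \<inter> orbit q ` B = {}"
    using permutes_orbit_subset[OF assms(1)] permutes_orbit_subset[OF assms(2)] assms(5)
      orbit_nonempty by fastforce
  ultimately show ?thesis
    using assms(3,4) by (simp add: num_orbits_def card_Un_disjoint)
qed

text \<open>The new map sends \<open>u\<close> to \<open>p v\<close> and then follows the old cycle
  of \<open>v\<close>, which avoids \<open>u\<close>. At \<open>v\<close> the next point of that
  cycle is \<open>p v\<close>, which has been reached already.\<close>

lemma orbit_comp_transpose_subset:
  assumes "p permutes A" "finite A" "v \<notin> orbit p u"
  shows "orbit p v \<subseteq> orbit (p \<circ> transpose u v) u"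
proof
  fix y assume "y \<in> orbit p v"
  then show "y \<in> orbit (p \<circ> transpose u v) u"
  proof induct
    case base
    show ?case by (metis comp_apply orbit.base transpose_apply_first)
  next
    case (step y)
    have "y \<noteq> u"
      using step(1) assms by (metis orbit_eq self_in_orbit)
    show ?case
    proof (cases "y = v")
      case True
      then show ?thesis by (metis comp_apply orbit.base transpose_apply_first)
    next
      case False
      then have "(p \<circ> transpose u v) y = p y"
        using \<open>y \<noteq> u\<close> by simp
      then show ?thesis using step(2) by (metis orbit.step)
    qed
  qed
qed

text \<open>Exchanging the images of \<open>u\<close> and \<open>v\<close> joins their two cycles
  into one and leaves all other cycles as they were.\<close>

lemma num_orbits_comp_transpose:
  assumes "p permutes A" "finite A" "u \<in> A" "v \<in> A" "v \<notin> orbit p u"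
  shows "num_orbits (p \<circ> transpose u v) A + 1 = num_orbits p A"
proof -
  let ?q = "p \<circ> transpose u v"
  have q: "?q permutes A"
    using assms by (simp add: permutes_compose permutes_swap_id)
  have vu: "u \<notin> orbit p v"
    using assms by (metis orbit_eq self_in_orbit)
  have sub: "orbit p u \<union> orbit p v \<subseteq> orbit ?q u"
  proof -
    have 1: "orbit p v \<subseteq> orbit ?q u"
      using orbit_comp_transpose_subset[OF assms(1,2,5)] .
    have 2: "orbit p u \<subseteq> orbit ?q v"
      using orbit_comp_transpose_subset[OF assms(1,2) vu] by (simp add: transpose_commute)
    have "v \<in> orbit ?q u"
      using 1 self_in_orbit[OF assms(1,2)] by blast
    then show ?thesis
      using 1 2 orbit_eq[OF q assms(2)] by blast
  qed
  have closed: "?q x \<in> orbit p u \<union> orbit p v" if "x \<in> orbit p u \<union> orbit p v" for x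
    using that orbit.intros[where f = p] unfolding comp_def transpose_def by auto
  have "orbit ?q u \<subseteq> orbit p u \<union> orbit p v"
  proof
    fix y assume "y \<in> orbit ?q u"
    then show "y \<in> orbit p u \<union> orbit p v"
    proof induct
      case base
      show ?case using self_in_orbit[OF assms(1,2)] by (intro closed) auto
    next
      case (step y)
      then show ?case using closed by blast
    qed
  qed
  with sub have merged: "orbit ?q u = orbit p u \<union> orbit p v" by blast
  have merged': "orbit ?q x = orbit p u \<union> orbit p v" if "x \<in> orbit p u \<union> orbit p v" for x
    using that merged orbit_eq[OF q assms(2)] by metis
  have other: "orbit ?q x = orbit p x" if "x \<notin> orbit p u \<union> orbit p v" for x
  proof (rule orbit_cong)
    show "x \<in> orbit p x" using self_in_orbit[OF assms(1,2)] .
    fix s assume s: "s \<in> orbit p x"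
    have "s \<noteq> u" "s \<noteq> v"
      using s that orbit_eq[OF assms(1,2)] self_in_orbit[OF assms(1,2)] by auto
    then show "?q s = p s" by simp
  qed
  let ?R = "orbit p ` A - {orbit p u, orbit p v}"
  have mem: "x \<in> orbit p u \<union> orbit p v \<longleftrightarrow> orbit p x \<in> {orbit p u, orbit p v}" for x
    using orbit_eq[OF assms(1,2)] self_in_orbit[OF assms(1,2)] by blast
  have "orbit ?q ` A = insert (orbit p u \<union> orbit p v) ?R"
  proof (intro equalityI subsetI)
    fix X assume "X \<in> orbit ?q ` A"
    then obtain x where "x \<in> A" "X = orbit ?q x" by blast
    then show "X \<in> insert (orbit p u \<union> orbit p v) ?R"
      using merged'[of x] other[of x] mem[of x] by (cases "x \<in> orbit p u \<union> orbit p v") auto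
  next
    fix X assume "X \<in> insert (orbit p u \<union> orbit p v) ?R"
    then consider "X = orbit ?q u" | x where "x \<in> A" "X = orbit p x" "x \<notin> orbit p u \<union> orbit p v"
      using merged mem by blast
    then show "X \<in> orbit ?q ` A"
      using assms(3) other by cases auto
  qed
  moreover have "orbit p u \<union> orbit p v \<notin> ?R"
  proof
    assume "orbit p u \<union> orbit p v \<in> ?R"
    then obtain x where "orbit p u \<union> orbit p v = orbit p x" by blast
    then have "u \<in> orbit p x" "v \<in> orbit p x"
      using self_in_orbit[OF assms(1,2)] by blast+
    then show False
      using assms orbit_eq[OF assms(1,2)] by metis
  qed
  moreover have "orbit p u \<noteq> orbit p v"
    using assms self_in_orbit by metis
  then have "card ?R + 2 = card (orbit p ` A)"
  proof -
    have sub: "{orbit p u, orbit p v} \<subseteq> orbit p ` A" using assms(3,4) by blast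
    \<comment> \<open>This bound keeps the natural-number subtraction in the size of the set
      difference from truncating.\<close>
    then have "card {orbit p u, orbit p v} \<le> card (orbit p ` A)"
      using assms(2) by (intro card_mono) auto
    then show ?thesis
      using sub \<open>orbit p u \<noteq> orbit p v\<close> by (simp add: card_Diff_subset)
  qed
  ultimately show ?thesis
    using assms(2) by (simp add: num_orbits_def)
qed

text \<open>The map \<open>p\<close> looks up the unique arc with a given tail; outside
  \<open>A\<close> it is the identity, as \<open>permutes\<close> demands.\<close>

lemma permutes_of_bijective_relation:
  assumes "inj_on fst R" "inj_on snd R" "fst ` R = A" "snd ` R = A"
  obtains p where "p permutes A" "R = (\<lambda>x. (x, p x)) ` A"
proof -
  define p where "p x = (if x \<in> A then snd (inv_into R fst x) else x)" for x
  have p: "p (fst e) = snd e" if "e \<in> R" for e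
    using that assms(1,3) by (auto simp: p_def)
  have "bij_betw p A A"
    unfolding bij_betw_def
  proof
    show "inj_on p A"
      using assms(2) p unfolding assms(3)[symmetric] inj_on_def by auto
    have "p ` A = snd ` R"
      using p unfolding assms(3)[symmetric] image_image by simp
    then show "p ` A = A" using assms(4) by simp
  qed
  then have "p permutes A"
    by (rule bij_imp_permutes) (simp add: p_def)
  moreover have "(\<lambda>x. (x, p x)) ` A = (\<lambda>e. (fst e, snd e)) ` R"
    using p unfolding assms(3)[symmetric] image_image by simp
  then have "R = (\<lambda>x. (x, p x)) ` A" by simp
  ultimately show ?thesis by (rule that)
qed

section \<open>Factors as permutations\<close>

text \<open>
  Deleting \<open>e\<close> and \<open>\<alpha> e\<close> and letting \<open>\<beta>\<close> match their former partners again
  yields a smaller instance; a transversal of it extends by whichever of \<open>e\<close>, \<open>\<alpha> e\<close> has its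
  \<open>\<beta>\<close>-partner outside.
\<close>

lemma common_transversal_of_involutions:
  assumes "finite A"
    and "\<And>x. x \<in> A \<Longrightarrow> \<alpha> x \<in> A \<and> \<alpha> x \<noteq> x \<and> \<alpha> (\<alpha> x) = x"
    and "\<And>x. x \<in> A \<Longrightarrow> \<beta> x \<in> A \<and> \<beta> x \<noteq> x \<and> \<beta> (\<beta> x) = x"
  shows "\<exists>M \<subseteq> A. \<forall>x \<in> A. (x \<in> M \<longleftrightarrow> \<alpha> x \<notin> M) \<and> (x \<in> M \<longleftrightarrow> \<beta> x \<notin> M)"
  using assms
proof (induction "card A" arbitrary: A \<beta> rule: less_induct)
  case less
  note a = less.prems(2) and b = less.prems(3)
  show ?case
  proof (cases "A = {}")
    case True
    then show ?thesis by simp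
  next
    case False
    then obtain e where e: "e \<in> A" by blast
    define f g where "f = \<alpha> e" and "g = \<beta> e"
    define h where "h = \<beta> f"
    define B where "B = A - {e, f}"
    have f: "f \<in> A" "f \<noteq> e" "\<alpha> f = e" and g: "g \<in> A" "g \<noteq> e" "\<beta> g = e"
      using a[OF e] b[OF e] by (auto simp: f_def g_def)
    have h: "h \<in> A" "h \<noteq> f" "\<beta> h = f"
      using b[OF f(1)] by (auto simp: h_def)
    have B: "finite B" "card B < card A"
      using less.prems(1) e by (auto simp: B_def intro!: psubset_card_mono)
    have aB: "\<alpha> x \<in> B \<and> \<alpha> x \<noteq> x \<and> \<alpha> (\<alpha> x) = x" if "x \<in> B" for x
      using that a[of x] f e by (auto simp: B_def f_def)
    \<comment> \<open>If \<open>g = f\<close>, then \<open>h = e\<close> and the update touches only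
      points outside \<open>B\<close>; otherwise \<open>g\<close> and \<open>h\<close> lie in
      \<open>B\<close> and become partners.\<close>
    define \<beta>' where "\<beta>' = \<beta>(g := h, h := g)"
    have hg: "g = f \<longleftrightarrow> h = e" "h \<noteq> g"
      using g h f by (auto simp: h_def g_def)
    have bB: "\<beta>' x \<in> B \<and> \<beta>' x \<noteq> x \<and> \<beta>' (\<beta>' x) = x" if "x \<in> B" for x
      using hg that b[of x] b[OF e] b[OF f(1)] g h f e
      unfolding B_def \<beta>'_def by (auto simp: g_def h_def)
    obtain M where M: "M \<subseteq> B" "\<And>x. x \<in> B \<Longrightarrow> (x \<in> M \<longleftrightarrow> \<alpha> x \<notin> M) \<and> (x \<in> M \<longleftrightarrow> \<beta>' x \<notin> M)"
      using less.hyps[OF B(2) B(1) aB bB] by blast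
    define N where "N = (if g \<in> M then insert f M else insert e M)"
    have "N \<subseteq> A" using M(1) e f by (auto simp: N_def B_def)
    moreover have "(x \<in> N \<longleftrightarrow> \<alpha> x \<notin> N) \<and> (x \<in> N \<longleftrightarrow> \<beta> x \<notin> N)" if x: "x \<in> A" for x
    proof -
      have notin: "e \<notin> M" "f \<notin> M" using M(1) by (auto simp: B_def)
      have ef: "e \<in> N \<longleftrightarrow> g \<notin> M" "f \<in> N \<longleftrightarrow> g \<in> M"
        using notin f by (auto simp: N_def)
      have NM: "y \<in> N \<longleftrightarrow> y \<in> M" if "y \<noteq> e" "y \<noteq> f" for y
        using that by (auto simp: N_def)
      have gh: "g = f \<and> h = e \<or> g \<in> B \<and> h \<in> B \<and> (g \<in> M \<longleftrightarrow> h \<notin> M)"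
      proof (cases "g = f")
        case False
        then have "g \<in> B" "h \<in> B" "\<beta>' g = h"
          using hg g h by (auto simp: B_def \<beta>'_def)
        then show ?thesis using M(2)[of g] by auto
      qed (use hg in simp)
      have gN: "g \<in> N \<longleftrightarrow> g \<in> M" and hN: "h \<in> N \<longleftrightarrow> g \<notin> M"
        using gh ef NM[of g] NM[of h] notin g(2) h(2) by (auto simp: B_def)
      consider "x = e" | "x = f" | "x = g" "x \<in> B" | "x = h" "x \<in> B" | "x \<in> B" "x \<noteq> g" "x \<noteq> h"
        using x by (auto simp: B_def)
      then show ?thesis
      proof cases
        case 1
        then show ?thesis using ef gN by (simp add: f_def[symmetric] g_def[symmetric])
      next
        case 2
        then show ?thesis using ef hN f(3) by (simp add: h_def[symmetric])
      next
        case 3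
        then show ?thesis using ef gh NM[of x] NM[of "\<alpha> x"] M(2)[of x] aB[of x] g notin
          by (auto simp: B_def)
      next
        case 4
        then show ?thesis using ef gh NM[of x] NM[of "\<alpha> x"] M(2)[of x] aB[of x] h notin
          by (auto simp: B_def)
      next
        case 5
        then have "\<beta>' x = \<beta> x" by (simp add: \<beta>'_def)
        then show ?thesis using 5 NM[of x] NM[of "\<alpha> x"] NM[of "\<beta> x"] M(2)[of x] aB[of x] bB[of x]
          by (auto simp: B_def)
      qed
    qed
    ultimately show ?thesis by blast
  qed
qed

section \<open>Factors and the permutations that follow arcs\<close>

text \<open>\<open>permutes\<close> makes such a map the identity off the vertex set, so each factor
  is represented by just one of them.\<close>

definition arc_perms :: "'a pair_pre_digraph \<Rightarrow> ('a \<Rightarrow> 'a) set" where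
  "arc_perms G = {p. p permutes pverts G \<and> (\<forall>x \<in> pverts G. (x, p x) \<in> parcs G)}"

definition perm_graph :: "'a set \<Rightarrow> ('a \<Rightarrow> 'a) \<Rightarrow> 'a pair_pre_digraph" where
  "perm_graph A p = \<lparr>pverts = A, parcs = (\<lambda>x. (x, p x)) ` A\<rparr>"

lemma pair_wf_digraph_perm_graph: "p permutes A \<Longrightarrow> pair_wf_digraph (perm_graph A p)"
  by unfold_locales (auto simp: perm_graph_def permutes_in_image)

lemma two_dd_fin: "two_dd G \<Longrightarrow> pair_fin_digraph G"
  by (simp add: two_dd_def two_digraph_def)

lemma two_dd_wf: "two_dd G \<Longrightarrow> pair_wf_digraph G"
  using two_dd_fin pair_fin_digraph.axioms(1) by blast

lemma two_dd_finite_verts: "two_dd G \<Longrightarrow> finite (pverts G)"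
  using two_dd_fin pair_fin_digraph.pair_finite_verts by blast

lemma two_dd_degrees:
  assumes "two_dd G" "x \<in> pverts G"
  shows "card {e \<in> parcs G. fst e = x} = 2" "card {e \<in> parcs G. snd e = x} = 2"
  using assms
  by (auto simp: two_dd_def saturated_def in_degree_def out_degree_def in_arcs_def out_arcs_def)

lemma two_ddI:
  assumes "finite (pverts G)" "parcs G \<subseteq> pverts G \<times> pverts G"
    and "\<And>x. x \<in> pverts G \<Longrightarrow> card {e \<in> parcs G. fst e = x} = 2"
    and "\<And>x. x \<in> pverts G \<Longrightarrow> card {e \<in> parcs G. snd e = x} = 2"
  shows "two_dd G"
proof -
  have "finite (parcs G)"
    using assms(1,2) by (meson finite_SigmaI finite_subset)
  then have "pair_fin_digraph G"
    using assms(1,2) by unfold_locales auto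
  then show ?thesis
    using assms
    by (auto simp: two_dd_def two_digraph_def saturated_def in_degree_def out_degree_def
        in_arcs_def out_arcs_def)
qed

text \<open>In a 2-dd every vertex has in-arcs and out-arcs, so both conditions of
  \<open>factor\<close> apply everywhere: tail and head are bijections from the arcs of
  \<open>F\<close> to the vertices.\<close>

lemma factor_iff:
  assumes "two_dd G"
  shows "factor G F \<longleftrightarrow> (\<exists>p \<in> arc_perms G. F = perm_graph (pverts G) p)"
proof
  assume F: "factor G F"
  then have sub: "pverts F = pverts G" "parcs F \<subseteq> parcs G" and "wf_digraph (with_proj F)"
    by (auto simp: factor_def spanning_def subgraph_def)
  then interpret F: pair_wf_digraph F
    by (simp add: wf_digraph_wp_iff)
  have one: "\<exists>!e. e \<in> parcs F \<and> fst e = x" "\<exists>!e. e \<in> parcs F \<and> snd e = x"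
    if "x \<in> pverts G" for x
  proof -
    have "{e \<in> parcs G. fst e = x} \<noteq> {}" "{e \<in> parcs G. snd e = x} \<noteq> {}"
      using two_dd_degrees[OF assms that] by (metis card.empty zero_neq_numeral)+
    then have "card {e \<in> parcs F. fst e = x} = 1" "card {e \<in> parcs F. snd e = x} = 1"
      using F that by (auto simp: factor_def in_arcs_def out_arcs_def)
    then show "\<exists>!e. e \<in> parcs F \<and> fst e = x" "\<exists>!e. e \<in> parcs F \<and> snd e = x"
      by (auto simp: card_1_singleton_iff set_eq_iff) metis+
  qed
  have ends: "fst e \<in> pverts G" "snd e \<in> pverts G" if "e \<in> parcs F" for e
    using that F.arc_fst_in_verts F.arc_snd_in_verts sub by auto
  have "inj_on fst (parcs F)" "inj_on snd (parcs F)"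
    using one ends unfolding inj_on_def by blast+
  moreover have "fst ` parcs F = pverts G" "snd ` parcs F = pverts G"
    using one ends by blast+
  ultimately obtain p where p: "p permutes pverts G" "parcs F = (\<lambda>x. (x, p x)) ` pverts G"
    using permutes_of_bijective_relation by blast
  have "p \<in> arc_perms G"
    using p sub by (auto simp: arc_perms_def)
  moreover have "F = perm_graph (pverts G) p"
    using p sub by (simp add: perm_graph_def)
  ultimately show "\<exists>p \<in> arc_perms G. F = perm_graph (pverts G) p" by blast
next
  assume "\<exists>p \<in> arc_perms G. F = perm_graph (pverts G) p"
  then obtain p where p: "p permutes pverts G" "\<And>x. x \<in> pverts G \<Longrightarrow> (x, p x) \<in> parcs G"
    and F: "F = perm_graph (pverts G) p"
    by (auto simp: arc_perms_def)
  have "spanning F G"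
    using p F two_dd_wf[OF assms] pair_wf_digraph_perm_graph[OF p(1)]
    by (auto simp: spanning_def subgraph_def compatible_def wf_digraph_wp_iff perm_graph_def)
  moreover have "in_arcs F x = {(inv p x, x)}" "out_arcs F x = {(x, p x)}" if "x \<in> pverts G" for x
    using that p(1) permutes_inverses[OF p(1)] permutes_in_image[OF permutes_inv[OF p(1)]]
    by (auto simp: F perm_graph_def in_arcs_def out_arcs_def image_iff)
  ultimately show "factor G F"
    by (simp add: factor_def)
qed

section \<open>Cycles in the graph of a permutation\<close>

text \<open>There is only one way to go on at each vertex, so start and length determine the arcs
  and the end of the walk.\<close>

lemma set_functional_walk:
  assumes "pcas u es w" "\<And>e. e \<in> set es \<Longrightarrow> snd e = p (fst e)"
  shows "set es = (\<lambda>i. ((p ^^ i) u, p ((p ^^ i) u))) ` {..<length es} \<and> w = (p ^^ length es) u"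
  using assms
proof (induction es arbitrary: u)
  case Nil
  then show ?case by simp
next
  case (Cons e es)
  have e: "e = (u, p u)" and walk: "pcas (p u) es w"
    using Cons.prems by (auto simp: prod_eq_iff)
  then have "set es = (\<lambda>i. ((p ^^ i) (p u), p ((p ^^ i) (p u)))) ` {..<length es}"
    and "w = (p ^^ length es) (p u)"
    using Cons by auto
  then show ?case
    by (simp add: e lessThan_Suc_eq_insert_0 image_image funpow_swap1)
qed

text \<open>A walk with \<open>n\<close> arcs has \<open>n + 1\<close> vertices. The induction
  removes the first arc, which moves the start to \<open>p u\<close> and shifts the indices.\<close>

lemma pawalk_verts_functional_walk:
  "pawalk_verts u (map (\<lambda>i. ((p ^^ i) u, (p ^^ Suc i) u)) [0..<n]) = map (\<lambda>i. (p ^^ i) u) [0..<Suc n]"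
proof (induction n arbitrary: u)
  case (Suc n)
  have "[0..<Suc k] = 0 # map Suc [0..<k]" for k
    by (simp add: map_Suc_upt upt_conv_Cons)
  then show ?case
    using Suc[of "p u"] by (simp add: funpow_swap1 comp_def del: upt_Suc)
qed simp

lemma pcas_functional_walk:
  "pcas u (map (\<lambda>i. ((p ^^ i) u, (p ^^ Suc i) u)) [0..<n]) ((p ^^ n) u)"
proof (induction n arbitrary: u)
  case (Suc n)
  have "[0..<Suc k] = 0 # map Suc [0..<k]" for k
    by (simp add: map_Suc_upt upt_conv_Cons)
  then show ?case
    using Suc[of "p u"] by (simp add: funpow_swap1 comp_def del: upt_Suc)
qed simp

text \<open>A closed walk of length \<open>n\<close> from \<open>u\<close> gives
  \<open>(p ^^ n) u = u\<close>, so the first \<open>n\<close> iterates already exhaust the orbit of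
  \<open>u\<close>.\<close>

lemma cycle_perm_graph_arcs:
  assumes "pre_digraph.cycle (perm_graph A p) es"
  obtains x where "x \<in> A" "set es = (\<lambda>y. (y, p y)) ` orbit p x"
proof -
  obtain u where u: "u \<in> A" "set es \<subseteq> (\<lambda>x. (x, p x)) ` A" "pcas u es u" "es \<noteq> []"
    using assms
    by (auto simp: pre_digraph.cycle_def pre_digraph.awalk_def perm_graph_def cas_with_proj_eq)
  have "snd e = p (fst e)" if "e \<in> set es" for e
    using that u(2) by auto
  then have "set es = (\<lambda>i. ((p ^^ i) u, p ((p ^^ i) u))) ` {..<length es}" "(p ^^ length es) u = u"
    using set_functional_walk[OF u(3)] by metis+
  moreover from this have "orbit p u = (\<lambda>i. (p ^^ i) u) ` {..<length es}"
    using orbit_altdef_bounded[of "length es" p u] u(4) by auto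
  ultimately show ?thesis
    using u(1) by (intro that[of u]) (simp_all add: image_image)
qed

lemma orbit_arcs_cycle:
  assumes "p permutes A" "finite A" "x \<in> A"
  obtains es where "pre_digraph.cycle (perm_graph A p) es" "set es = (\<lambda>y. (y, p y)) ` orbit p x"
proof -
  have self: "x \<in> orbit p x"
    using self_in_orbit[OF assms(1,2)] .
  \<comment> \<open>The least positive return time: the walk closes up after \<open>n\<close> arcs,
    and no vertex repeats before.\<close>
  define n where "n = funpow_dist1 p x x"
  define es where "es = map (\<lambda>i. ((p ^^ i) x, (p ^^ Suc i) x)) [0..<n]"
  have n: "0 < n" "(p ^^ n) x = x"
    using funpow_dist1_prop[OF self] by (simp_all only: n_def)
  have orb: "orbit p x = (\<lambda>i. (p ^^ i) x) ` {0..<n}"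
    unfolding n_def by (rule orbit_conv_funpow_dist1[OF self])
  then have set: "set es = (\<lambda>y. (y, p y)) ` orbit p x"
    by (simp add: es_def image_image)
  have "inj_on (\<lambda>i. (p ^^ i) x) {0..<n}"
    using inj_on_funpow_dist1[OF self] by (simp only: n_def)
  \<comment> \<open>A cycle requires the vertices after the first to be distinct. These are the
    heads of the arcs; injectivity of \<open>p\<close> transfers distinctness to them from the
    tails.\<close>
  then have "inj_on (\<lambda>i. p ((p ^^ i) x)) {0..<n}"
    using permutes_inj[OF assms(1)] by (auto simp: inj_on_def)
  moreover have "tl (pawalk_verts x es) = map (\<lambda>i. p ((p ^^ i) x)) [0..<n]"
    unfolding es_def pawalk_verts_functional_walk
    by (simp add: upt_conv_Cons map_Suc_upt[symmetric] comp_def del: upt_Suc)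
  ultimately have "distinct (tl (pawalk_verts x es))"
    by (simp add: distinct_map)
  moreover have "pcas x es x"
    using pcas_functional_walk[of x p n] n(2) by (simp only: es_def)
  moreover have "set es \<subseteq> (\<lambda>x. (x, p x)) ` A"
    using set permutes_orbit_subset[OF assms(1,3)] by auto
  moreover have "es \<noteq> []"
    using n(1) by (simp add: es_def)
  ultimately have "pre_digraph.cycle (perm_graph A p) es"
    using assms(3)
    by (auto simp: pre_digraph.cycle_def pre_digraph.awalk_def cas_with_proj_eq
        awalk_verts_with_proj_eq perm_graph_def)
  then show ?thesis using set by (rule that)
qed

text \<open>The two preceding lemmas match the arc sets of cycles with orbits. An orbit is recovered
  as the set of tails of its arcs, so the matching is one to one.\<close>

lemma index_perm_graph:
  assumes "p permutes A" "finite A"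
  shows "index (perm_graph A p) = num_orbits p A"
proof -
  let ?g = "\<lambda>B. (\<lambda>y. (y, p y)) ` B"
  have "{set es |es. pre_digraph.cycle (perm_graph A p) es} = ?g ` (orbit p ` A)"
  proof (intro equalityI subsetI)
    fix X assume "X \<in> {set es |es. pre_digraph.cycle (perm_graph A p) es}"
    then show "X \<in> ?g ` (orbit p ` A)"
      using cycle_perm_graph_arcs[of A p] by (smt (verit) image_eqI mem_Collect_eq)
  next
    fix X assume "X \<in> ?g ` (orbit p ` A)"
    then show "X \<in> {set es |es. pre_digraph.cycle (perm_graph A p) es}"
      using orbit_arcs_cycle[OF assms] by (smt (verit) image_iff mem_Collect_eq)
  qed
  moreover have "inj_on ?g (orbit p ` A)"
    by (rule inj_onI) (simp add: inj_image_eq_iff inj_on_def)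
  ultimately show ?thesis
    unfolding index_def num_orbits_def by (simp only: card_image)
qed

lemma index_arc_perm:
  assumes "two_dd G" "p \<in> arc_perms G"
  shows "index (perm_graph (pverts G) p) = num_orbits p (pverts G)"
  using assms index_perm_graph two_dd_finite_verts by (auto simp: arc_perms_def)

lemma odd_two_dd_iff:
  "odd_two_dd G \<longleftrightarrow> two_dd G \<and> (\<forall>p \<in> arc_perms G. odd (num_orbits p (pverts G)))"
  unfolding odd_two_dd_def by (metis factor_iff index_arc_perm)

lemma even_two_dd_iff:
  "even_two_dd G \<longleftrightarrow> two_dd G \<and> (\<forall>p \<in> arc_perms G. even (num_orbits p (pverts G)))"
  unfolding even_two_dd_def by (metis factor_iff index_arc_perm)

lemma map_fst_eq_pawalk_verts: "pcas u es w \<Longrightarrow> map fst es @ [w] = pawalk_verts u es"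
  by (induction es arbitrary: u) auto

lemma tl_pawalk_verts: "pcas u es w \<Longrightarrow> tl (pawalk_verts u es) = map snd es"
proof (induction es arbitrary: u)
  case (Cons e es)
  then show ?case by (cases es) auto
qed simp

text \<open>The successor map along a cycle through all vertices is a permutation with one orbit.
  Conversely, the cycle around the only orbit lies in \<open>G\<close>, because a factor is a
  subgraph.\<close>

lemma hamiltonian_iff:
  assumes "two_dd G"
  shows "hamiltonian G \<longleftrightarrow> (\<exists>p \<in> arc_perms G. num_orbits p (pverts G) = 1)"
proof
  assume "hamiltonian G"
  then obtain es u where es: "fst ` set es = pverts G" "u \<in> pverts G" "set es \<subseteq> parcs G"
      "pcas u es u" "distinct (tl (pawalk_verts u es))" "es \<noteq> []"
    by (auto simp: hamiltonian_def pre_digraph.cycle_def pre_digraph.awalk_def cas_with_proj_eq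
        awalk_verts_with_proj_eq)
  have snd: "distinct (map snd es)"
    using es tl_pawalk_verts by metis
  \<comment> \<open>Cancelling \<open>u\<close> makes tails and heads equal as multisets, so
    distinctness passes from the heads to the tails.\<close>
  have "map fst es @ [u] = u # map snd es"
    using map_fst_eq_pawalk_verts[OF es(4)] tl_pawalk_verts[OF es(4)] es(4,6)
    by (cases es) auto
  from arg_cong[OF this, of mset] have m: "mset (map fst es) = mset (map snd es)"
    by simp
  have fst: "distinct (map fst es)" "snd ` set es = pverts G"
    using snd es(1) mset_eq_imp_distinct_iff[OF m] mset_eq_setD[OF m] by simp_all
  obtain p where p: "p permutes pverts G" "set es = (\<lambda>x. (x, p x)) ` pverts G"
    using permutes_of_bijective_relation[of "set es" "pverts G"] fst snd es(1)
    unfolding distinct_map by blast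
  have "p \<in> arc_perms G"
    using p es(3) by (auto simp: arc_perms_def)
  have "snd e = p (fst e)" if "e \<in> set es" for e
    using that p(2) by auto
  then have "set es = (\<lambda>i. ((p ^^ i) u, p ((p ^^ i) u))) ` {..<length es}"
    using set_functional_walk[OF es(4)] by metis
  then have "pverts G = (\<lambda>i. (p ^^ i) u) ` {..<length es}"
    using es(1) by (simp add: image_image)
  moreover have "(p ^^ i) u \<in> orbit p u" for i
    using funpow_in_orbit[OF self_in_orbit[OF p(1) two_dd_finite_verts[OF assms]]] .
  ultimately have "pverts G \<subseteq> orbit p u" by auto
  then have "orbit p ` pverts G = {orbit p u}"
    using es(2) orbit_eq[OF p(1) two_dd_finite_verts[OF assms]] by blast
  then have "num_orbits p (pverts G) = 1"
    by (simp add: num_orbits_def)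
  with \<open>p \<in> arc_perms G\<close> show "\<exists>p \<in> arc_perms G. num_orbits p (pverts G) = 1" by blast
next
  assume "\<exists>p \<in> arc_perms G. num_orbits p (pverts G) = 1"
  then obtain p where p: "p permutes pverts G" "p \<in> arc_perms G"
    and one: "card (orbit p ` pverts G) = 1"
    by (auto simp: arc_perms_def num_orbits_def)
  obtain x where x: "x \<in> pverts G"
    using one by fastforce
  have self: "y \<in> orbit p y" for y
    using self_in_orbit[OF p(1) two_dd_finite_verts[OF assms]] .
  have orb: "orbit p x = pverts G"
  proof
    show "orbit p x \<subseteq> pverts G"
      by (rule permutes_orbit_subset[OF p(1) x])
    have "orbit p y = orbit p x" if "y \<in> pverts G" for y
      using one that x by (metis card_1_singletonE imageI singletonD)
    then show "pverts G \<subseteq> orbit p x"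
      using self by blast
  qed
  obtain es where es: "pre_digraph.cycle (perm_graph (pverts G) p) es"
      "set es = (\<lambda>y. (y, p y)) ` orbit p x"
    using orbit_arcs_cycle[OF p(1) two_dd_finite_verts[OF assms] x] .
  have "subgraph (with_proj (perm_graph (pverts G) p)) (with_proj G)"
    using p(2) factor_iff[OF assms] by (auto simp: factor_def spanning_def)
  then have "pre_digraph.cycle G es"
    using wf_digraph.subgraph_cycle es(1) two_dd_wf[OF assms] wf_digraph_wp_iff by blast
  moreover have "fst ` set es = pverts G"
    using es(2) orb by (simp add: image_image)
  ultimately show "hamiltonian G"
    by (auto simp: hamiltonian_def)
qed

section \<open>Existence of factors\<close>

text \<open>Exchanging the two elements of each fibre is an involution without fixed points.\<close>

lemma other_element_of_fibre:
  assumes "\<And>x. x \<in> A \<Longrightarrow> card {y \<in> A. f y = f x} = 2"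
  shows "\<exists>\<alpha>. \<forall>x \<in> A. \<alpha> x \<in> A \<and> \<alpha> x \<noteq> x \<and> \<alpha> (\<alpha> x) = x \<and> {y \<in> A. f y = f x} = {x, \<alpha> x}"
proof -
  have "\<exists>z. z \<noteq> x \<and> {y \<in> A. f y = f x} = {x, z}" if x: "x \<in> A" for x
  proof -
    obtain a b where ab: "{y \<in> A. f y = f x} = {a, b}" "a \<noteq> b"
      using assms[OF x] by (auto simp: card_2_iff)
    then have "x = a \<or> x = b"
      using x by blast
    then show ?thesis
    proof
      assume "x = a"
      with ab show ?thesis by (intro exI[of _ b]) simp
    next
      assume "x = b"
      with ab show ?thesis by (intro exI[of _ a]) (simp add: insert_commute)
    qed
  qed
  then obtain \<alpha> where \<alpha>: "\<And>x. x \<in> A \<Longrightarrow> \<alpha> x \<noteq> x \<and> {y \<in> A. f y = f x} = {x, \<alpha> x}"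
    by metis
  have "\<alpha> x \<in> A \<and> \<alpha> x \<noteq> x \<and> \<alpha> (\<alpha> x) = x" if "x \<in> A" for x
  proof -
    have *: "\<alpha> x \<in> A" "f (\<alpha> x) = f x" "\<alpha> x \<noteq> x"
      using \<alpha>[OF that] by auto
    then have "{\<alpha> x, \<alpha> (\<alpha> x)} = {x, \<alpha> x}"
      using \<alpha>[OF that] \<alpha>[of "\<alpha> x"] by simp
    then show ?thesis
      using * by (simp add: doubleton_eq_iff)
  qed
  with \<alpha> show ?thesis by blast
qed

text \<open>Let \<open>\<alpha>\<close> exchange the two arcs with a common tail and
  \<open>\<beta>\<close> those with a common head. Applied in turn they trace out the alternating
  cycles; a common transversal takes every second arc of each, hence one out-arc and one in-arc per
  vertex.\<close>

lemma arc_perms_nonempty: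
  assumes "two_dd G"
  shows "arc_perms G \<noteq> {}"
proof -
  let ?E = "parcs G"
  interpret pair_fin_digraph G
    using two_dd_fin[OF assms] .
  have "card {d \<in> ?E. fst d = fst e} = 2" "card {d \<in> ?E. snd d = snd e} = 2" if "e \<in> ?E" for e
    using that two_dd_degrees[OF assms] arc_fst_in_verts arc_snd_in_verts by auto
  note deg = this
  have "\<exists>\<alpha>. \<forall>e \<in> ?E. \<alpha> e \<in> ?E \<and> \<alpha> e \<noteq> e \<and> \<alpha> (\<alpha> e) = e \<and>
      {d \<in> ?E. fst d = fst e} = {e, \<alpha> e}"
    by (rule other_element_of_fibre) (rule deg(1))
  then obtain \<alpha> where "\<forall>e \<in> ?E. \<alpha> e \<in> ?E \<and> \<alpha> e \<noteq> e \<and> \<alpha> (\<alpha> e) = e \<and>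
      {d \<in> ?E. fst d = fst e} = {e, \<alpha> e}" ..
  then have \<alpha>: "\<And>e. e \<in> ?E \<Longrightarrow> \<alpha> e \<in> ?E \<and> \<alpha> e \<noteq> e \<and> \<alpha> (\<alpha> e) = e"
      "\<And>e. e \<in> ?E \<Longrightarrow> {d \<in> ?E. fst d = fst e} = {e, \<alpha> e}"
    by simp_all
  have "\<exists>\<beta>. \<forall>e \<in> ?E. \<beta> e \<in> ?E \<and> \<beta> e \<noteq> e \<and> \<beta> (\<beta> e) = e \<and>
      {d \<in> ?E. snd d = snd e} = {e, \<beta> e}"
    by (rule other_element_of_fibre) (rule deg(2))
  then obtain \<beta> where "\<forall>e \<in> ?E. \<beta> e \<in> ?E \<and> \<beta> e \<noteq> e \<and> \<beta> (\<beta> e) = e \<and>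
      {d \<in> ?E. snd d = snd e} = {e, \<beta> e}" ..
  then have \<beta>: "\<And>e. e \<in> ?E \<Longrightarrow> \<beta> e \<in> ?E \<and> \<beta> e \<noteq> e \<and> \<beta> (\<beta> e) = e"
      "\<And>e. e \<in> ?E \<Longrightarrow> {d \<in> ?E. snd d = snd e} = {e, \<beta> e}"
    by simp_all
  have "\<exists>M \<subseteq> ?E. \<forall>e \<in> ?E. (e \<in> M \<longleftrightarrow> \<alpha> e \<notin> M) \<and> (e \<in> M \<longleftrightarrow> \<beta> e \<notin> M)"
    by (rule common_transversal_of_involutions[OF pair_finite_arcs \<alpha>(1) \<beta>(1)])
  then obtain M where M: "M \<subseteq> ?E"
      "\<forall>e \<in> ?E. (e \<in> M \<longleftrightarrow> \<alpha> e \<notin> M) \<and> (e \<in> M \<longleftrightarrow> \<beta> e \<notin> M)"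
    by (elim exE conjE) (rule that)
  have "d = e" if "d \<in> M" "e \<in> M" "fst d = fst e" for d e
  proof -
    have E: "d \<in> ?E" "e \<in> ?E"
      using that M(1) by blast+
    then have "d \<in> {e, \<alpha> e}"
      using \<alpha>(2)[OF E(2)] that(3) by blast
    then show ?thesis
      using that(1,2) bspec[OF M(2) E(2)] by blast
  qed
  then have "inj_on fst M" by (rule inj_onI)
  moreover have "d = e" if "d \<in> M" "e \<in> M" "snd d = snd e" for d e
  proof -
    have E: "d \<in> ?E" "e \<in> ?E"
      using that M(1) by blast+
    then have "d \<in> {e, \<beta> e}"
      using \<beta>(2)[OF E(2)] that(3) by blast
    then show ?thesis
      using that(1,2) bspec[OF M(2) E(2)] by blast
  qed
  then have "inj_on snd M" by (rule inj_onI)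
  moreover have "fst ` M = pverts G"
  proof (intro equalityI subsetI)
    fix x assume x: "x \<in> pverts G"
    then have "{e \<in> ?E. fst e = x} \<noteq> {}"
      using two_dd_degrees(1)[OF assms x] by (metis card.empty zero_neq_numeral)
    then obtain e where e: "e \<in> ?E" "fst e = x" by blast
    have "\<alpha> e \<in> {d \<in> ?E. fst d = fst e}"
      using \<alpha>(2)[OF e(1)] by simp
    then have "fst (\<alpha> e) = x"
      using e(2) by simp
    moreover have "e \<in> M \<or> \<alpha> e \<in> M"
      using bspec[OF M(2) e(1)] by blast
    ultimately show "x \<in> fst ` M"
      using e(2) by (metis imageI)
  qed (auto dest!: subsetD[OF M(1)] dest: in_arcsD1)
  moreover have "snd ` M = pverts G"
  proof (intro equalityI subsetI)
    fix x assume x: "x \<in> pverts G"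
    then have "{e \<in> ?E. snd e = x} \<noteq> {}"
      using two_dd_degrees(2)[OF assms x] by (metis card.empty zero_neq_numeral)
    then obtain e where e: "e \<in> ?E" "snd e = x" by blast
    have "\<beta> e \<in> {d \<in> ?E. snd d = snd e}"
      using \<beta>(2)[OF e(1)] by simp
    then have "snd (\<beta> e) = x"
      using e(2) by simp
    moreover have "e \<in> M \<or> \<beta> e \<in> M"
      using bspec[OF M(2) e(1)] by blast
    ultimately show "x \<in> snd ` M"
      using e(2) by (metis imageI)
  qed (auto dest!: subsetD[OF M(1)] dest: in_arcsD2)
  ultimately obtain p where "p permutes pverts G" "M = (\<lambda>x. (x, p x)) ` pverts G"
    using permutes_of_bijective_relation by blast
  then have "p \<in> arc_perms G"
    using M(1) by (auto simp: arc_perms_def)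
  then show ?thesis by blast
qed

section \<open>Connected components\<close>

definition induced :: "'a pair_pre_digraph \<Rightarrow> 'a set \<Rightarrow> 'a pair_pre_digraph" where
  "induced G A = \<lparr>pverts = A, parcs = {e \<in> parcs G. fst e \<in> A \<and> snd e \<in> A}\<rparr>"

text \<open>Connectedness as a property of the vertex set, so that components become maximal
  sets.\<close>

definition connected_on :: "'a pair_pre_digraph \<Rightarrow> 'a set \<Rightarrow> bool" where
  "connected_on G A \<longleftrightarrow> A \<noteq> {} \<and> A \<subseteq> pverts G \<and>
     (\<forall>x \<in> A. \<forall>y \<in> A. (x, y) \<in> rtrancl_on A ((parcs G \<inter> A \<times> A)\<^sup>s))"

lemma induced_subgraph_iff:
  assumes "pair_wf_digraph G"
  shows "induced_subgraph (with_proj H) (with_proj G) \<longleftrightarrow>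
    pverts H \<subseteq> pverts G \<and> H = induced G (pverts H)"
proof -
  have "pair_wf_digraph (induced G A)" for A
    by unfold_locales (auto simp: induced_def)
  moreover have "H = induced G (pverts H) \<longleftrightarrow>
      parcs H = {e \<in> parcs G. fst e \<in> pverts H \<and> snd e \<in> pverts H}"
    by (cases H) (auto simp: induced_def)
  ultimately show ?thesis
    using assms
    unfolding induced_subgraph_def subgraph_def compatible_def wf_digraph_wp_iff with_proj_simps
    by (metis (no_types, lifting) mem_Collect_eq subsetI)
qed

lemma connected_induced_iff:
  "A \<subseteq> pverts G \<Longrightarrow> Digraph_Component.connected (with_proj (induced G A)) \<longleftrightarrow> connected_on G A"
proof -
  have "{e \<in> parcs G. fst e \<in> A \<and> snd e \<in> A} = parcs G \<inter> A \<times> A" by auto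
  then show "A \<subseteq> pverts G \<Longrightarrow> ?thesis"
    by (simp add: connected_conv connected_on_def induced_def)
qed

text \<open>Maximality may range over vertex sets instead of subgraphs, since every connected set
  \<open>B\<close> is the vertex set of \<open>induced G B\<close>.\<close>

lemma components_iff:
  assumes "pair_wf_digraph G"
  shows "H \<in> components G \<longleftrightarrow> H = induced G (pverts H) \<and> connected_on G (pverts H) \<and>
    (\<forall>B. connected_on G B \<longrightarrow> \<not> pverts H \<subset> B)"
proof -
  have c: "induced_subgraph (with_proj K) (with_proj G) \<and> Digraph_Component.connected (with_proj K)
      \<longleftrightarrow> K = induced G (pverts K) \<and> connected_on G (pverts K)" for K
    using induced_subgraph_iff[OF assms] connected_induced_iff[of "pverts K" G]
    by (metis connected_on_def)
  have "(\<exists>K. (K = induced G (pverts K) \<and> connected_on G (pverts K)) \<and> pverts H \<subset> pverts K)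
      \<longleftrightarrow> (\<exists>B. connected_on G B \<and> pverts H \<subset> B)"
  proof
    assume "\<exists>B. connected_on G B \<and> pverts H \<subset> B"
    then obtain B where "connected_on G B" "pverts H \<subset> B" by blast
    moreover have "pverts (induced G B) = B" by (simp add: induced_def)
    ultimately show "\<exists>K. (K = induced G (pverts K) \<and> connected_on G (pverts K)) \<and> pverts H \<subset> pverts K"
      by metis
  qed blast
  then show ?thesis
    unfolding components_def mem_Collect_eq using c by (metis (no_types, lifting))
qed

lemma connected_on_Un:
  assumes "connected_on G A" "connected_on G B" "A \<inter> B \<noteq> {}"
  shows "connected_on G (A \<union> B)"
proof -
  obtain z where z: "z \<in> A" "z \<in> B" using assms(3) by blast
  let ?r = "\<lambda>C. rtrancl_on C ((parcs G \<inter> C \<times> C)\<^sup>s)"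
  have mono: "(x, y) \<in> ?r D" if "(x, y) \<in> ?r C" "C \<subseteq> D" for x y C D
    using _ that(2,1) by (rule rtrancl_on_mono) (use that(2) in \<open>auto simp: symcl_def\<close>)
  have via: "(x, z) \<in> ?r (A \<union> B) \<and> (z, x) \<in> ?r (A \<union> B)" if "x \<in> A \<union> B" for x
  proof (cases "x \<in> A")
    case True
    then have "(x, z) \<in> ?r A" "(z, x) \<in> ?r A"
      using z assms(1) by (simp_all add: connected_on_def)
    then show ?thesis using mono[of _ _ A "A \<union> B"] by simp
  next
    case False
    then have "(x, z) \<in> ?r B" "(z, x) \<in> ?r B"
      using that z assms(2) by (simp_all add: connected_on_def)
    then show ?thesis using mono[of _ _ B "A \<union> B"] by simp
  qed
  have "(x, y) \<in> ?r (A \<union> B)" if "x \<in> A \<union> B" "y \<in> A \<union> B" for x y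
    by (rule rtrancl_on_trans[of x z]) (simp_all only: via[OF that(1)] via[OF that(2)])
  then show ?thesis
    using assms(1,2) unfolding connected_on_def by simp
qed

lemma connected_on_singleton: "x \<in> pverts G \<Longrightarrow> connected_on G {x}"
  by (simp add: connected_on_def)

lemma connected_on_arc:
  assumes "pair_wf_digraph G" "(x, y) \<in> parcs G"
  shows "connected_on G {x, y}"
proof -
  interpret pair_wf_digraph G by fact
  let ?R = "(parcs G \<inter> {x, y} \<times> {x, y})\<^sup>s"
  have "(x, y) \<in> ?R" "(y, x) \<in> ?R"
    using assms(2) by (auto simp: symcl_def)
  then have "(x, y) \<in> rtrancl_on {x, y} ?R" "(y, x) \<in> rtrancl_on {x, y} ?R"
    by (auto intro: rtrancl_on_into_rtrancl_on)
  then show ?thesis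
    using in_arcsD1[OF assms(2)] in_arcsD2[OF assms(2)] by (auto simp: connected_on_def)
qed

text \<open>The union of the component with \<open>A\<close> is connected, so maximality leaves no
  room for new vertices.\<close>

lemma connected_on_subset_component:
  assumes "pair_wf_digraph G" "H \<in> components G" "connected_on G A" "A \<inter> pverts H \<noteq> {}"
  shows "A \<subseteq> pverts H"
proof -
  have "connected_on G (pverts H \<union> A)" "\<not> pverts H \<subset> pverts H \<union> A"
    using assms connected_on_Un[of G "pverts H" A] components_iff[OF assms(1), of H] by blast+
  then show ?thesis by blast
qed

lemma component_arc_closed:
  assumes "pair_wf_digraph G" "H \<in> components G" "(x, y) \<in> parcs G"
  shows "x \<in> pverts H \<longleftrightarrow> y \<in> pverts H"
  using connected_on_subset_component[OF assms(1,2) connected_on_arc[OF assms(1,3)]] by blast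

lemma parcs_component:
  assumes "pair_wf_digraph G" "H \<in> components G"
  shows "parcs H = {e \<in> parcs G. fst e \<in> pverts H \<and> snd e \<in> pverts H}"
  using components_iff[OF assms(1), of H] assms(2) unfolding induced_def
  by (metis (no_types, lifting) pair_pre_digraph.select_convs(2))

lemma components_disjoint:
  assumes "pair_wf_digraph G" "H \<in> components G" "K \<in> components G" "H \<noteq> K"
  shows "pverts H \<inter> pverts K = {}"
proof (rule ccontr)
  assume "pverts H \<inter> pverts K \<noteq> {}"
  then have "pverts H \<subseteq> pverts K" "pverts K \<subseteq> pverts H"
    using assms connected_on_subset_component components_iff[OF assms(1)] by blast+
  then have "H = K"
    using assms components_iff[OF assms(1)] by (metis subset_antisym)
  then show False using assms(4) by contradiction
qed

text \<open>Finiteness provides a maximal connected set around any vertex, starting from the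
  singleton.\<close>

lemma Union_components:
  assumes "pair_fin_digraph G"
  shows "\<Union> (pverts ` components G) = pverts G"
proof (intro equalityI subsetI)
  interpret pair_fin_digraph G by fact
  have wf: "pair_wf_digraph G" ..
  fix x assume x: "x \<in> pverts G"
  let ?S = "{A. connected_on G A \<and> x \<in> A}"
  have fin: "finite ?S"
    by (rule finite_subset[of _ "Pow (pverts G)"])
      (auto simp: connected_on_def pair_finite_verts)
  have "{x} \<in> ?S"
    using connected_on_singleton[OF x] by simp
  from finite_has_maximal2[OF fin this]
  obtain A where "A \<in> ?S" and max: "\<forall>B \<in> ?S. A \<subseteq> B \<longrightarrow> A = B"
    by (elim bexE conjE)
  then have A: "connected_on G A" "x \<in> A"
    by simp_all
  \<comment> \<open>A connected superset of \<open>A\<close> also contains \<open>x\<close>, so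
    maximality within \<open>?S\<close> is maximality among all connected sets.\<close>
  have "\<not> A \<subset> B" if "connected_on G B" for B
  proof
    assume "A \<subset> B"
    moreover from this have "B \<in> ?S"
      using that A(2) by auto
    ultimately show False
      using max by auto
  qed
  moreover have "pverts (induced G A) = A"
    by (simp add: induced_def)
  ultimately have "induced G A \<in> components G"
    using A(1) by (simp add: components_iff[OF wf])
  then show "x \<in> \<Union> (pverts ` components G)"
    using A(2) \<open>pverts (induced G A) = A\<close> by blast
next
  interpret pair_fin_digraph G by fact
  have wf: "pair_wf_digraph G" ..
  fix x assume "x \<in> \<Union> (pverts ` components G)"
  then show "x \<in> pverts G"
    using components_iff[OF wf] by (auto simp: connected_on_def)
qed

text \<open>As \<open>card\<close> is 0 on infinite sets, this is what turns the existence of a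
  component into a positive number of components.\<close>

lemma finite_components:
  assumes "pair_fin_digraph G"
  shows "finite (components G)"
proof -
  interpret pair_fin_digraph G by fact
  have wf: "pair_wf_digraph G" ..
  have "components G \<subseteq> induced G ` Pow (pverts G)"
  proof
    fix H assume "H \<in> components G"
    then have "H = induced G (pverts H)" "pverts H \<subseteq> pverts G"
      using components_iff[OF wf] by (auto simp: connected_on_def)
    then show "H \<in> induced G ` Pow (pverts G)" by blast
  qed
  then show ?thesis
    using pair_finite_verts by (meson finite_Pow_iff finite_imageI finite_subset)
qed

section \<open>Crosswise splicing\<close>

text \<open>
  \<open>H\<close> and \<open>K\<close> stand for the two spliced graphs; \<open>\<rho>\<close> identifies their vertices with those of \<open>G\<close>.
  Splitting \<open>u\<close>, \<open>v\<close> and splicing crosswise makes \<open>u\<close> and \<open>v\<close> swap their out-arcs, so that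
  permutations of \<open>G\<close> and of \<open>H \<union> K\<close> differ by a transposition.
\<close>

locale crosswise_splice =
  fixes G :: "'a pair_pre_digraph" and H K :: "'b pair_pre_digraph"
    and \<rho> :: "'b \<Rightarrow> 'a" and u v :: 'a and a b :: 'b
  assumes two_dd: "two_dd G"
    and disjoint: "pverts H \<inter> pverts K = {}"
    and bij: "bij_betw \<rho> (pverts H \<union> pverts K) (pverts G)"
    and H_wf: "parcs H \<subseteq> pverts H \<times> pverts H"
    and K_wf: "parcs K \<subseteq> pverts K \<times> pverts K"
    and arc_iff: "\<And>x y. x \<in> pverts H \<union> pverts K \<Longrightarrow> y \<in> pverts H \<union> pverts K \<Longrightarrow>
      (x, y) \<in> parcs H \<union> parcs K \<longleftrightarrow> (transpose u v (\<rho> x), \<rho> y) \<in> parcs G"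
    and a: "a \<in> pverts H" "\<rho> a = u"
    and b: "b \<in> pverts K" "\<rho> b = v"
begin

abbreviation "U \<equiv> pverts H \<union> pverts K"

lemma finite_verts: "finite (pverts H)" "finite (pverts K)"
  using two_dd_finite_verts[OF two_dd] bij bij_betw_finite by (metis finite_Un)+

lemma uv_in_verts: "u \<in> pverts G" "v \<in> pverts G"
  using a b bij by (auto simp: bij_betw_def)

lemma bij_tail: "bij_betw (transpose u v \<circ> \<rho>) U (pverts G)"
  using bij permutes_imp_bij[OF permutes_swap_id[OF uv_in_verts]] by (rule bij_betw_trans)

text \<open>Tails pass through the transposition and heads do not; both maps are bijections of
  vertices, and \<open>arc_iff\<close> says that arcs correspond.\<close>

lemma bij_arcs: "bij_betw (map_prod (transpose u v \<circ> \<rho>) \<rho>) (parcs H \<union> parcs K) (parcs G)"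
  unfolding bij_betw_def
proof
  show "inj_on (map_prod (transpose u v \<circ> \<rho>) \<rho>) (parcs H \<union> parcs K)"
  proof (rule inj_on_subset)
    show "inj_on (map_prod (transpose u v \<circ> \<rho>) \<rho>) (U \<times> U)"
      using bij_tail bij by (intro map_prod_inj_on) (simp_all add: bij_betw_def)
    show "parcs H \<union> parcs K \<subseteq> U \<times> U"
      using H_wf K_wf by blast
  qed
  show "map_prod (transpose u v \<circ> \<rho>) \<rho> ` (parcs H \<union> parcs K) = parcs G"
  proof (intro equalityI subsetI)
    fix e assume "e \<in> map_prod (transpose u v \<circ> \<rho>) \<rho> ` (parcs H \<union> parcs K)"
    then obtain d where "d \<in> parcs H \<union> parcs K" "e = map_prod (transpose u v \<circ> \<rho>) \<rho> d"
      by (rule imageE)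
    then obtain x y where xy: "(x, y) \<in> parcs H \<union> parcs K" "e = (transpose u v (\<rho> x), \<rho> y)"
      by (cases d) simp
    moreover have "x \<in> U" "y \<in> U"
      using xy(1) H_wf K_wf by blast+
    ultimately show "e \<in> parcs G"
      using arc_iff by simp
  next
    fix e assume e: "e \<in> parcs G"
    interpret pair_wf_digraph G
      using two_dd_wf[OF two_dd] .
    have "fst e \<in> (transpose u v \<circ> \<rho>) ` U" "snd e \<in> \<rho> ` U"
      using bij_tail bij e arc_fst_in_verts arc_snd_in_verts unfolding bij_betw_def by auto
    then obtain x y where x: "fst e = (transpose u v \<circ> \<rho>) x" "x \<in> U" and y: "snd e = \<rho> y" "y \<in> U"
      by (elim imageE) (rule that)
    have xy: "x \<in> U" "y \<in> U" "e = (transpose u v (\<rho> x), \<rho> y)"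
      using x y by (simp_all add: prod_eq_iff)
    then have "(x, y) \<in> parcs H \<union> parcs K"
      using arc_iff e by simp
    then show "e \<in> map_prod (transpose u v \<circ> \<rho>) \<rho> ` (parcs H \<union> parcs K)"
      using xy(3) by (auto intro!: image_eqI[of _ _ "(x, y)"])
  qed
qed

lemma degrees:
  assumes "x \<in> U"
  shows "card {e \<in> parcs H \<union> parcs K. fst e = x} = 2"
    and "card {e \<in> parcs H \<union> parcs K. snd e = x} = 2"
proof -
  let ?f = "map_prod (transpose u v \<circ> \<rho>) \<rho>" and ?E = "parcs H \<union> parcs K"
  have ends: "fst e \<in> U" "snd e \<in> U" if "e \<in> ?E" for e
    using that H_wf K_wf by auto
  have "card {e \<in> ?E. fst e = x} = card {e \<in> parcs G. fst e = (transpose u v \<circ> \<rho>) x}"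
  proof (rule card_Collect_bij_betw[OF bij_arcs])
    fix e assume "e \<in> ?E"
    then show "fst (?f e) = (transpose u v \<circ> \<rho>) x \<longleftrightarrow> fst e = x"
      using inj_on_eq_iff[OF bij_betw_imp_inj_on[OF bij_tail] ends(1) assms] by simp
  qed
  then show "card {e \<in> ?E. fst e = x} = 2"
    using two_dd_degrees(1)[OF two_dd] bij_betwE[OF bij_tail] assms by simp
  have "card {e \<in> ?E. snd e = x} = card {e \<in> parcs G. snd e = \<rho> x}"
  proof (rule card_Collect_bij_betw[OF bij_arcs])
    fix e assume "e \<in> ?E"
    then show "snd (?f e) = \<rho> x \<longleftrightarrow> snd e = x"
      using inj_on_eq_iff[OF bij_betw_imp_inj_on[OF bij] ends(2) assms] by simp
  qed
  then show "card {e \<in> ?E. snd e = x} = 2"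
    using two_dd_degrees(2)[OF two_dd] bij_betwE[OF bij] assms by simp
qed

lemma two_dd_parts: "two_dd H" "two_dd K"
proof -
  have "{e \<in> parcs H. fst e = x} = {e \<in> parcs H \<union> parcs K. fst e = x}"
    "{e \<in> parcs H. snd e = x} = {e \<in> parcs H \<union> parcs K. snd e = x}" if "x \<in> pverts H" for x
    using that K_wf disjoint by auto
  then show "two_dd H"
    using finite_verts(1) H_wf degrees by (intro two_ddI) simp_all
  have "{e \<in> parcs K. fst e = x} = {e \<in> parcs H \<union> parcs K. fst e = x}"
    "{e \<in> parcs K. snd e = x} = {e \<in> parcs H \<union> parcs K. snd e = x}" if "x \<in> pverts K" for x
    using that H_wf disjoint by auto
  then show "two_dd K"
    using finite_verts(2) K_wf degrees by (intro two_ddI) simp_all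
qed

text \<open>The cycles through \<open>u\<close> and \<open>v\<close> lie in different parts, and the transposition merges them.\<close>

lemma num_orbits_splice:
  assumes "r permutes U" "q permutes pverts G" "h \<in> arc_perms H" "k \<in> arc_perms K"
    and "\<And>x. x \<in> pverts H \<Longrightarrow> r x = h x" "\<And>x. x \<in> pverts K \<Longrightarrow> r x = k x"
    and "\<And>x. x \<in> U \<Longrightarrow> q (\<rho> x) = \<rho> (r x)"
  shows "num_orbits (q \<circ> transpose u v) (pverts G) + 1 =
    num_orbits h (pverts H) + num_orbits k (pverts K)"
proof -
  have h: "h permutes pverts H" and k: "k permutes pverts K"
    using assms by (simp_all add: arc_perms_def)
  have fin: "finite U" using finite_verts by simp
  have inj: "inj_on \<rho> U" and img: "\<rho> ` U = pverts G"
    using bij by (auto simp: bij_betw_def)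
  have q: "q = map_permutation U \<rho> r"
  proof
    fix y
    show "q y = map_permutation U \<rho> r y"
    proof (cases "y \<in> pverts G")
      case True
      then obtain x where "x \<in> U" "y = \<rho> x"
        using img by blast
      then show ?thesis
        using assms(7) map_permutation_apply[OF inj] by simp
    next
      case False
      then show ?thesis
        using permutes_not_in[OF assms(2)]
          permutes_not_in[OF map_permutation_permutes[OF bij assms(1)]] by simp
    qed
  qed
  have "orbit q u = \<rho> ` orbit r a"
  proof -
    have "q (\<rho> x) = \<rho> (r x)" if "x \<in> orbit r a" for x
      using that assms(7) permutes_orbit_subset[OF assms(1), of a] a(1) by blast
    then show ?thesis
      using orbit_inverse[of a r q \<rho>] self_in_orbit[OF assms(1) fin] a(2) by metis
  qed
  moreover have "orbit r a \<subseteq> pverts H"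
  proof
    fix x assume "x \<in> orbit r a"
    then show "x \<in> pverts H"
      by induct (use assms(5) a(1) permutes_in_image[OF h] in auto)
  qed
  ultimately have "v \<notin> orbit q u"
    using inj b disjoint unfolding inj_on_def by blast
  then have "num_orbits (q \<circ> transpose u v) (pverts G) + 1 = num_orbits q (pverts G)"
    using num_orbits_comp_transpose[OF assms(2) two_dd_finite_verts[OF two_dd] uv_in_verts]
    by simp
  also have "\<dots> = num_orbits r U"
    unfolding q by (rule num_orbits_map_permutation[OF assms(1) fin bij])
  also have "\<dots> = num_orbits h (pverts H) + num_orbits k (pverts K)"
    by (rule num_orbits_Un[OF h k finite_verts disjoint assms(5,6)])
  finally show ?thesis .
qed

text \<open>Together \<open>h\<close> and \<open>k\<close> permute the union, and
  \<open>\<rho>\<close> transports this to \<open>G\<close>; composing with the transposition makes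
  the result follow arcs of \<open>G\<close>.\<close>

lemma splice_arc_perms:
  assumes "h \<in> arc_perms H" "k \<in> arc_perms K"
  shows "\<exists>p \<in> arc_perms G. num_orbits p (pverts G) + 1 =
    num_orbits h (pverts H) + num_orbits k (pverts K)"
proof -
  have h: "h permutes pverts H" "\<And>x. x \<in> pverts H \<Longrightarrow> (x, h x) \<in> parcs H"
    and k: "k permutes pverts K" "\<And>x. x \<in> pverts K \<Longrightarrow> (x, k x) \<in> parcs K"
    using assms by (simp_all add: arc_perms_def)
  \<comment> \<open>Each of \<open>h\<close> and \<open>k\<close> is the identity on the other part,
    so the composite acts as \<open>h\<close> on one part and as \<open>k\<close> on the
    other.\<close>
  define r where "r = h \<circ> k"
  have r: "r permutes U"
    unfolding r_def using h(1) k(1) by (meson permutes_compose permutes_subset sup_ge1 sup_ge2)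
  have rh: "r x = h x" if "x \<in> pverts H" for x
  proof -
    have "x \<notin> pverts K" using that disjoint by blast
    then show ?thesis using permutes_not_in[OF k(1)] by (simp add: r_def)
  qed
  have rk: "r x = k x" if "x \<in> pverts K" for x
  proof -
    have "k x \<notin> pverts H" using that disjoint permutes_in_image[OF k(1), of x] by blast
    then show ?thesis using permutes_not_in[OF h(1)] by (simp add: r_def)
  qed
  define q where "q = map_permutation U \<rho> r"
  have q: "q permutes pverts G"
    unfolding q_def by (rule map_permutation_permutes[OF bij r])
  have qr: "q (\<rho> x) = \<rho> (r x)" if "x \<in> U" for x
    using bij that by (simp add: q_def bij_betw_def map_permutation_apply)
  have "(x, (q \<circ> transpose u v) x) \<in> parcs G" if "x \<in> pverts G" for x
  proof -
    \<comment> \<open>With \<open>x\<close> in this form the transposition in the composite cancels,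
      and the required arc is the one that \<open>arc_iff\<close> attaches to
      \<open>(y, r y)\<close>.\<close>
    have "x \<in> (transpose u v \<circ> \<rho>) ` U"
      using that bij_betw_imp_surj_on[OF bij_tail] by simp
    then obtain y where y: "x = transpose u v (\<rho> y)" "y \<in> U"
      unfolding comp_apply by (rule imageE)
    have "(y, r y) \<in> parcs H \<union> parcs K"
      using y(2) h(2) k(2) rh rk by auto
    moreover have "r y \<in> U"
      using y(2) permutes_in_image[OF r] by blast
    ultimately show ?thesis
      using arc_iff[OF y(2)] y qr by simp
  qed
  moreover have "q \<circ> transpose u v permutes pverts G"
    using q permutes_swap_id[OF uv_in_verts] by (simp add: permutes_compose)
  ultimately have "q \<circ> transpose u v \<in> arc_perms G"
    by (simp add: arc_perms_def)
  then show ?thesis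
    using num_orbits_splice[OF r q assms rh rk qr] by blast
qed

text \<open>The inverse construction: undo the transposition, pull back along \<open>\<rho>\<close>
  and restrict. An arc that starts in a part ends in it, so the pulled-back permutation preserves
  both parts.\<close>

lemma split_arc_perms:
  assumes "p \<in> arc_perms G"
  shows "\<exists>h \<in> arc_perms H. \<exists>k \<in> arc_perms K. num_orbits p (pverts G) + 1 =
    num_orbits h (pverts H) + num_orbits k (pverts K)"
proof -
  have p: "p permutes pverts G" "\<And>x. x \<in> pverts G \<Longrightarrow> (x, p x) \<in> parcs G"
    using assms by (simp_all add: arc_perms_def)
  define q where "q = p \<circ> transpose u v"
  have q: "q permutes pverts G"
    unfolding q_def using p(1) permutes_swap_id[OF uv_in_verts] by (simp add: permutes_compose)
  define r where "r = map_permutation (pverts G) (inv_into U \<rho>) q"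
  have inv: "bij_betw (inv_into U \<rho>) (pverts G) U"
    by (rule bij_betw_inv_into[OF bij])
  have r: "r permutes U"
    unfolding r_def by (rule map_permutation_permutes[OF inv q])
  have qr: "q (\<rho> x) = \<rho> (r x)" if "x \<in> U" for x
  proof -
    have x: "\<rho> x \<in> pverts G" "inv_into U \<rho> (\<rho> x) = x"
      using that bij by (auto simp: bij_betw_def)
    then have "r x = inv_into U \<rho> (q (\<rho> x))"
      using map_permutation_apply[OF bij_betw_imp_inj_on[OF inv] x(1), of q] by (simp add: r_def)
    moreover have "q (\<rho> x) \<in> \<rho> ` U"
      using x(1) permutes_in_image[OF q] bij by (simp add: bij_betw_def)
    ultimately show ?thesis
      by (simp add: f_inv_into_f)
  qed
  have arc: "(x, r x) \<in> parcs H \<union> parcs K" if "x \<in> U" for x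
  proof -
    have "transpose u v (\<rho> x) \<in> pverts G"
      using that bij_tail by (auto simp: bij_betw_def)
    then have "(transpose u v (\<rho> x), q (\<rho> x)) \<in> parcs G"
      using p(2) by (fastforce simp: q_def)
    then show ?thesis
      using arc_iff[OF that] qr[OF that] permutes_in_image[OF r] that by simp
  qed
  have arcH: "(x, r x) \<in> parcs H" if "x \<in> pverts H" for x
    using arc[of x] that K_wf disjoint by blast
  have arcK: "(x, r x) \<in> parcs K" if "x \<in> pverts K" for x
    using arc[of x] that H_wf disjoint by blast
  have restrict: "(\<lambda>x. if x \<in> A then r x else x) permutes A"
    if "finite A" "\<And>x. x \<in> A \<Longrightarrow> r x \<in> A" for A
  proof (rule bij_imp_permutes)
    have inj: "inj_on (\<lambda>x. if x \<in> A then r x else x) A"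
      using permutes_inj[OF r] by (auto simp: inj_on_def)
    have "(\<lambda>x. if x \<in> A then r x else x) ` A \<subseteq> A"
      using that(2) by auto
    from endo_inj_surj[OF that(1) this inj] show "bij_betw (\<lambda>x. if x \<in> A then r x else x) A A"
      using inj unfolding bij_betw_def by (intro conjI)
  qed simp
  let ?h = "\<lambda>x. if x \<in> pverts H then r x else x"
    and ?k = "\<lambda>x. if x \<in> pverts K then r x else x"
  have h: "?h \<in> arc_perms H"
    using restrict[OF finite_verts(1)] arcH H_wf by (auto simp: arc_perms_def)
  have k: "?k \<in> arc_perms K"
    using restrict[OF finite_verts(2)] arcK K_wf by (auto simp: arc_perms_def)
  have "q \<circ> transpose u v = p"
    by (simp add: q_def comp_assoc)
  moreover have "num_orbits (q \<circ> transpose u v) (pverts G) + 1 =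
    num_orbits ?h (pverts H) + num_orbits ?k (pverts K)"
    by (rule num_orbits_splice[OF r q h k _ _ qr]) simp_all
  ultimately show ?thesis
    using h k by auto
qed

text \<open>Both orbit counts are at least 1, so their sum is 2 exactly if each of them is
  1.\<close>

lemma hamiltonian_iff_parts: "hamiltonian G \<longleftrightarrow> hamiltonian H \<and> hamiltonian K"
proof -
  have pos: "num_orbits h (pverts H) > 0" "num_orbits k (pverts K) > 0" for h k
    by (rule num_orbits_pos[OF finite_verts(1) a(1)], rule num_orbits_pos[OF finite_verts(2) b(1)])
  show ?thesis
    unfolding hamiltonian_iff[OF two_dd] hamiltonian_iff[OF two_dd_parts(1)]
      hamiltonian_iff[OF two_dd_parts(2)]
  proof
    assume "\<exists>p \<in> arc_perms G. num_orbits p (pverts G) = 1"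
    then obtain h k where hk: "h \<in> arc_perms H" "k \<in> arc_perms K"
      "num_orbits h (pverts H) + num_orbits k (pverts K) = 2"
      using split_arc_perms by fastforce
    then have "num_orbits h (pverts H) = 1" "num_orbits k (pverts K) = 1"
      using hk(3) pos(1)[of h] pos(2)[of k] by linarith+
    then show "(\<exists>p \<in> arc_perms H. num_orbits p (pverts H) = 1) \<and>
        (\<exists>p \<in> arc_perms K. num_orbits p (pverts K) = 1)"
      using hk by blast
  next
    assume "(\<exists>p \<in> arc_perms H. num_orbits p (pverts H) = 1) \<and>
        (\<exists>p \<in> arc_perms K. num_orbits p (pverts K) = 1)"
    then show "\<exists>p \<in> arc_perms G. num_orbits p (pverts G) = 1"
      using splice_arc_perms by fastforce
  qed
qed

text \<open>The two counts add up to one more than an odd number, so they have equal parity for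
  every pair \<open>h\<close>, \<open>k\<close>.\<close>

lemma even_parts:
  assumes "odd_two_dd G" "even_two_dd H \<or> even_two_dd K"
  shows "even_two_dd H" "even_two_dd K"
proof -
  have parity: "even (num_orbits h (pverts H)) \<longleftrightarrow> even (num_orbits k (pverts K))"
    if hk: "h \<in> arc_perms H" "k \<in> arc_perms K" for h k
  proof -
    obtain p where "p \<in> arc_perms G"
      "num_orbits p (pverts G) + 1 = num_orbits h (pverts H) + num_orbits k (pverts K)"
      using splice_arc_perms[OF hk] by blast
    then show ?thesis
      using assms(1) unfolding odd_two_dd_iff by (metis even_add odd_one)
  qed
  \<comment> \<open>Evenness passes from one part to the other by comparison with a fixed
    permutation, so each part must have one.\<close>
  obtain h k where "h \<in> arc_perms H" "k \<in> arc_perms K"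
    using arc_perms_nonempty two_dd_parts by blast
  then show "even_two_dd H" "even_two_dd K"
    using assms(2) parity two_dd_parts unfolding even_two_dd_iff by blast+
qed

lemma not_hamiltonian:
  assumes "even_two_dd H"
  shows "\<not> hamiltonian G"
proof
  assume "hamiltonian G"
  then obtain h where "h \<in> arc_perms H" "num_orbits h (pverts H) = 1"
    using hamiltonian_iff_parts hamiltonian_iff[OF two_dd_parts(1)] by blast
  then show False
    using assms unfolding even_two_dd_iff by fastforce
qed

end

section \<open>Splitting two vertices and splicing a component\<close>

lemma pair_fin_digraph_split_graph:
  assumes "pair_fin_digraph G" "S \<subseteq> pverts G"
  shows "pair_fin_digraph (split_graph G S)"
proof -
  interpret pair_fin_digraph G by fact
  show ?thesis
    using pair_finite_verts pair_finite_arcs finite_subset[OF assms(2)] in_arcsD1 in_arcsD2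
    by unfold_locales (auto simp: split_graph_def)
qed

text \<open>On the split graph this becomes injective once the out-parts are dropped; it then serves
  as \<open>\<rho>\<close>.\<close>

primrec unsplit :: "'a split_vertex \<Rightarrow> 'a" where
  "unsplit (Orig x) = x"
| "unsplit (Vin x) = x"
| "unsplit (Vout x) = x"

abbreviation out_part :: "'a set \<Rightarrow> 'a \<Rightarrow> 'a split_vertex" where
  "out_part S x \<equiv> if x \<in> S then Vout x else Orig x"

abbreviation in_part :: "'a set \<Rightarrow> 'a \<Rightarrow> 'a split_vertex" where
  "in_part S x \<equiv> if x \<in> S then Vin x else Orig x"

lemma in_split_graph_cases:
  assumes "x \<in> pverts (split_graph G {p, q})"
  obtains w where "x = Orig w" "w \<in> pverts G" "w \<noteq> p" "w \<noteq> q"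
    | "x = Vin p" | "x = Vin q" | "x = Vout p" | "x = Vout q"
  using assms by (auto simp: split_graph_def)

lemma split_graph_arc_iff:
  "(x, y) \<in> parcs (split_graph G S) \<longleftrightarrow>
    (\<exists>s t. (s, t) \<in> parcs G \<and> x = out_part S s \<and> y = in_part S t)"
  by (force simp: split_graph_def)

text \<open>One orientation for both components: \<open>p\<close>, \<open>q\<close> are
  \<open>u\<close>, \<open>v\<close> for \<open>G1\<close> and \<open>v\<close>, \<open>u\<close>
  for \<open>G2\<close>. The spliced vertex keeps the name \<open>Vin p\<close>.\<close>

locale spliced_component =
  fixes G :: "'a pair_pre_digraph" and p q :: 'a and K :: "'a split_vertex pair_pre_digraph"
  assumes fin: "pair_fin_digraph G"
    and verts: "p \<in> pverts G" "q \<in> pverts G" "p \<noteq> q"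
    and component: "K \<in> components (split_graph G {p, q})"
    and inside: "Vin p \<in> pverts K" "Vout q \<in> pverts K"
    and outside: "Vout p \<notin> pverts K" "Vin q \<notin> pverts K"
begin

lemma split_wf: "pair_wf_digraph (split_graph G {p, q})"
  using pair_fin_digraph_split_graph[OF fin, of "{p, q}"] verts pair_fin_digraph.axioms(1) by blast

lemma subset_split: "pverts K \<subseteq> pverts (split_graph G {p, q})"
  using component components_iff[OF split_wf] by (auto simp: connected_on_def)

lemma pverts_splice: "pverts (splice_verts K (Vin p) (Vout q)) = pverts K - {Vout q}"
  using inside by (auto simp: splice_verts_def Let_def)

text \<open>The transposition pairs \<open>Vin p\<close> with \<open>Vout q\<close>, both inside
  \<open>K\<close>, and \<open>Vin q\<close> with \<open>Vout p\<close>, both outside; every unsplit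
  vertex is paired with itself.\<close>

lemma tail_in_component_iff:
  assumes "x \<in> pverts (split_graph G {p, q})" "x \<notin> {Vout p, Vout q}"
  shows "out_part {p, q} (transpose p q (unsplit x)) \<in> pverts K \<longleftrightarrow> x \<in> pverts K"
  using assms(1) by (rule in_split_graph_cases) (use assms(2) inside outside in auto)

lemma in_part_unsplit:
  assumes "x \<in> pverts (split_graph G {p, q})" "x \<notin> {Vout p, Vout q}"
  shows "in_part {p, q} (unsplit x) = x"
  using assms(1) by (rule in_split_graph_cases) (use assms(2) in auto)

lemma split_arc:
  assumes "y \<in> pverts (split_graph G {p, q})" "y \<notin> {Vout p, Vout q}" "(s, unsplit y) \<in> parcs G"
  shows "(out_part {p, q} s, y) \<in> parcs (split_graph G {p, q})"
  unfolding split_graph_arc_iff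
  by (rule exI[of _ s], rule exI[of _ "unsplit y"])
    (simp only: assms(3) in_part_unsplit[OF assms(1,2)] simp_thms)

lemma component_closed:
  assumes "x \<in> pverts (split_graph G {p, q})" "x \<notin> {Vout p, Vout q}"
    and "y \<in> pverts (split_graph G {p, q})" "y \<notin> {Vout p, Vout q}"
    and "(transpose p q (unsplit x), unsplit y) \<in> parcs G"
  shows "x \<in> pverts K \<longleftrightarrow> y \<in> pverts K"
proof -
  have "(out_part {p, q} (transpose p q (unsplit x)), y) \<in> parcs (split_graph G {p, q})"
    by (rule split_arc[OF assms(3-5)])
  then show ?thesis
    using component_arc_closed[OF split_wf component] tail_in_component_iff[OF assms(1,2)] by blast
qed

text \<open>The vertex \<open>Vin p\<close> keeps the in-arcs of \<open>p\<close> and receives the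
  out-arcs of \<open>q\<close>. Hence heads are read off directly, and tails after exchanging
  \<open>p\<close> and \<open>q\<close>.\<close>

lemma parcs_splice_iff:
  "(x, y) \<in> parcs (splice_verts K (Vin p) (Vout q)) \<longleftrightarrow>
    x \<in> pverts K - {Vout q} \<and> y \<in> pverts K - {Vout q} \<and>
    (transpose p q (unsplit x), unsplit y) \<in> parcs G"
proof
  let ?r = "\<lambda>z. if z = Vout q then Vin p else z"
  assume "(x, y) \<in> parcs (splice_verts K (Vin p) (Vout q))"
  then obtain c d where cd: "(c, d) \<in> parcs K" "x = ?r c" "y = ?r d"
    by (auto simp: splice_verts_def Let_def)
  then have K: "c \<in> pverts K" "d \<in> pverts K" and "(c, d) \<in> parcs (split_graph G {p, q})"
    using parcs_component[OF split_wf component] by auto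
  then obtain s t where st: "(s, t) \<in> parcs G" "c = out_part {p, q} s" "d = in_part {p, q} t"
    unfolding split_graph_arc_iff by blast
  \<comment> \<open>Since \<open>Vout p\<close> is outside \<open>K\<close>, only the tail
    \<open>q\<close> gets renamed: it appears as \<open>Vin p\<close>, and the transposition turns
    \<open>p\<close> back into \<open>q\<close>.\<close>
  have "s \<noteq> p"
    using K(1) st(2) outside(1) by auto
  then have "transpose p q (unsplit x) = s"
    using cd(2) st(2) by auto
  moreover have "d \<noteq> Vout q" "unsplit y = t"
    using cd(3) st(3) by auto
  ultimately show "x \<in> pverts K - {Vout q} \<and> y \<in> pverts K - {Vout q} \<and>
      (transpose p q (unsplit x), unsplit y) \<in> parcs G"
    using cd K st(1) inside(1) by auto
next
  let ?r = "\<lambda>z. if z = Vout q then Vin p else z"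
  assume xy: "x \<in> pverts K - {Vout q} \<and> y \<in> pverts K - {Vout q} \<and>
    (transpose p q (unsplit x), unsplit y) \<in> parcs G"
  then have x: "x \<in> pverts (split_graph G {p, q})" "x \<notin> {Vout p, Vout q}"
    and y: "y \<in> pverts (split_graph G {p, q})" "y \<notin> {Vout p, Vout q}"
    using subset_split outside(1) by auto
  \<comment> \<open>The tail before splicing, which the renaming \<open>?r\<close> takes to
    \<open>x\<close>.\<close>
  let ?c = "out_part {p, q} (transpose p q (unsplit x))"
  have "(?c, y) \<in> parcs (split_graph G {p, q})"
    using split_arc[OF y] xy by blast
  moreover have "?c \<in> pverts K"
    using tail_in_component_iff[OF x] xy by blast
  ultimately have "(?c, y) \<in> parcs K"
    using parcs_component[OF split_wf component] xy by simp
  moreover have "?r ?c = x"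
    using x(1) by (rule in_split_graph_cases) (use xy outside verts in auto)
  moreover have "?r y = y"
    using y by simp
  ultimately show "(x, y) \<in> parcs (splice_verts K (Vin p) (Vout q))"
    unfolding splice_verts_def Let_def
    by (auto intro!: image_eqI[of _ _ "(?c, y)"] simp del: split_paired_Ex)
qed

end

theorem theorem3:
  fixes G :: "'a pair_pre_digraph"
    and G1 G2 G1' G2' :: "'a split_vertex pair_pre_digraph"
    and u v :: 'a
  assumes "two_dd G"
    and "\<And>es. alternating_cycle G es \<Longrightarrow> odd_alternating_cycle G es"
    and "odd_two_dd G"
    and "minimal_split_set G {u, v}"
    and "components (split_graph G {u, v}) = {G1, G2}"
    and "Vin u \<in> pverts G1" and "Vout v \<in> pverts G1"
    and "Vout u \<in> pverts G2" and "Vin v \<in> pverts G2"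
    and "G1' = splice_verts G1 (Vin u) (Vout v)"
    and "G2' = splice_verts G2 (Vin v) (Vout u)"
  shows "(hamiltonian G \<longleftrightarrow> hamiltonian G1' \<and> hamiltonian G2') \<and>
    (even_two_dd G1' \<or> even_two_dd G2' \<longrightarrow>
       even_two_dd G1' \<and> even_two_dd G2' \<and> \<not> hamiltonian G)"
proof -
  let ?Sp = "split_graph G {u, v}"
  have fin: "pair_fin_digraph G"
    using two_dd_fin[OF assms(1)] .
  have uv: "u \<in> pverts G" "v \<in> pverts G"
    using assms(4) by (auto simp: minimal_split_set_def split_set_def saturated_def)
  have split_fin: "pair_fin_digraph ?Sp"
    using pair_fin_digraph_split_graph[OF fin] uv by simp
  then have split_wf: "pair_wf_digraph ?Sp"
    by (rule pair_fin_digraph.axioms(1))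
  \<comment> \<open>\<open>G\<close> has at least one component and splitting yields more, so
    \<open>G1\<close> and \<open>G2\<close> cannot coincide.\<close>
  have "components G \<noteq> {}"
    using Union_components[OF fin] uv by auto
  then have "0 < card (components G)"
    using finite_components[OF fin] by (simp add: card_gt_0_iff)
  moreover have "card (components G) < card {G1, G2}"
    using assms(4,5) by (simp add: minimal_split_set_def split_set_def)
  ultimately have "G1 \<noteq> G2"
    by auto
  then have disj: "pverts G1 \<inter> pverts G2 = {}"
    using components_disjoint[OF split_wf] assms(5) by blast
  have cover: "pverts G1 \<union> pverts G2 = pverts ?Sp"
    using Union_components[OF split_fin] assms(5) by simp
  \<comment> \<open>Otherwise \<open>Vin u\<close> would lie in both components.\<close>
  have "u \<noteq> v"
    using disj assms(6,9) by blast
  interpret one: spliced_component G u v G1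
    using fin uv \<open>u \<noteq> v\<close> assms(5-9) disj by (intro spliced_component.intro) auto
  interpret two: spliced_component G v u G2
    using fin uv \<open>u \<noteq> v\<close> assms(5-9) disj
    by (intro spliced_component.intro) (auto simp: insert_commute)
  have H: "pverts G1' = pverts G1 - {Vout v}" and K: "pverts G2' = pverts G2 - {Vout u}"
    using one.pverts_splice two.pverts_splice assms(10,11) by simp_all
  have union: "pverts G1' \<union> pverts G2' = pverts ?Sp - {Vout u, Vout v}"
    using H K cover disj assms(6-9) by blast
  interpret crosswise_splice G G1' G2' unsplit u v "Vin u" "Vin v"
  proof
    show "two_dd G" by fact
    show "pverts G1' \<inter> pverts G2' = {}"
      using H K disj by blast
    \<comment> \<open>Each vertex of \<open>G\<close> survives exactly once, with
      \<open>Vin u\<close> and \<open>Vin v\<close> standing for \<open>u\<close> and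
      \<open>v\<close>; this makes \<open>unsplit\<close> a bijection.\<close>
    have "pverts ?Sp - {Vout u, Vout v} = Orig ` (pverts G - {u, v}) \<union> {Vin u, Vin v}"
      by (auto simp: split_graph_def)
    then have verts: "pverts G1' \<union> pverts G2' = Orig ` (pverts G - {u, v}) \<union> {Vin u, Vin v}"
      using union by simp
    show "bij_betw unsplit (pverts G1' \<union> pverts G2') (pverts G)"
      unfolding verts bij_betw_def using uv \<open>u \<noteq> v\<close> by (auto simp: inj_on_def image_Un image_image)
    show "parcs G1' \<subseteq> pverts G1' \<times> pverts G1'"
      using one.parcs_splice_iff unfolding assms(10) one.pverts_splice by auto
    show "parcs G2' \<subseteq> pverts G2' \<times> pverts G2'"
      using two.parcs_splice_iff unfolding assms(11) two.pverts_splice by auto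
    show "(x, y) \<in> parcs G1' \<union> parcs G2' \<longleftrightarrow> (transpose u v (unsplit x), unsplit y) \<in> parcs G"
      if xy: "x \<in> pverts G1' \<union> pverts G2'" "y \<in> pverts G1' \<union> pverts G2'" for x y
    proof -
      \<comment> \<open>After the exchange of tails no arc of \<open>G\<close> runs between the two
        components, so each lands in one of the spliced graphs.\<close>
      have "x \<in> pverts G1 \<longleftrightarrow> y \<in> pverts G1"
        if "(transpose u v (unsplit x), unsplit y) \<in> parcs G"
        using xy that unfolding union by (intro one.component_closed) auto
      then show ?thesis
        using xy one.parcs_splice_iff[of x y] two.parcs_splice_iff[of x y] disj
        unfolding assms(10,11) one.pverts_splice two.pverts_splice transpose_commute[of v u] by blast
    qed
    show "Vin u \<in> pverts G1'" "Vin v \<in> pverts G2'"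
      using H K assms(6,9) by auto
  qed simp_all
  have "even_two_dd G1' \<or> even_two_dd G2' \<Longrightarrow> even_two_dd G1' \<and> even_two_dd G2' \<and> \<not> hamiltonian G"
    using even_parts[OF assms(3)] not_hamiltonian by blast
  then show ?thesis
    using hamiltonian_iff_parts by blast
qed

end
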